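(* Let $0<\delta<1$, $t>1$, $\lambda_c:=\frac{1}{t^{1-\delta}-1}$, let $\lambda_c\le\lambda\le t^{1-\delta}-1$, write $\lambda=\lambda_c(1+\Lambda)$ and $\omega:=\sqrt{\frac{\lambda_c t}{2}}\frac{\ln(1+\Lambda)}{1+\lambda_c}$. Let $J_B$ be as in the context with $\sigma=1/2$. Let $m\ge4$ be a natural number and let $a=a(t)$ satisfy $a\gg t^{-\delta/2}$ and $$t^{\epsilon-\frac{\delta}{2}+\frac{\delta}{4m+2}}\ll a\ll t^{-\frac{\delta}{2}+\frac{\delta}{4m-2}}$$ for some $\epsilon>0$, and set $k:=t^{\delta-1}(1-a)$. Then, as $t\to\infty$, $$J_B(t;\lambda)=\sum_{j=0}^{m-3}T_j(t;\lambda)+{\cal O}\!\left((4m-5)!!\,t^{-\frac12-\frac{(4m-5)\delta}{2}}(\ln t)^{(4m-3)/2}a^{-4m+4}\right)$$ $$+\exp\!\big({\rm i} tF(1-t^{\delta-1};\lambda)-{\rm i}\omega^2\big)\,t^{-1/2}\sqrt{\frac{2}{1+\lambda_c}}\left(\int_\omega^{\omega+a\sqrt{\lambda_c t/2}}{\rm e}^{{\rm i}\xi^2}\,{\rm d}\xi\right)+{\cal O}\!\left(t^{-\frac12+\frac{3\delta}{2}}a^4\right),$$ where the ${\cal O}$ terms are independent of $\lambda$, and each $T_j$ satisfies $T_j(t;\lambda)={\cal O}\!\left((2j-1)!!\,t^{-\frac12-\frac{(2j+1)\delta}{2}}a^{-2j-1}\right)$.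
   Context: $F(z;\lambda):=(1-z)\ln(1-z)+z\ln z+z\ln\lambda$ with branch cuts $(-\infty,0]$ and $[1,\infty)$; $\partial F/\partial z=\ln\big(\frac{z\lambda}{1-z}\big)$. With $\phi$ satisfying $0<\phi<\pi/2$ if $\ln\lambda\ge0$ and $0<\phi<\arctan(\pi/|\ln\lambda|)$ if $\ln\lambda<0$, $J_B(t;\lambda):=\int_{1-t^{\delta-1}}^{\infty{\rm e}^{{\rm i}\phi}}(1-z)^{-1/2}\exp({\rm i} tF(z;\lambda))\,{\rm d} z$ (integration from the endpoint to infinity along a ray of angle $\phi$). The terms are $$T_j(t;\lambda):=-\left(\frac{-1}{{\rm i} t\,\partial F/\partial z}\cdot\frac{\partial}{\partial z}\right)^j\left(\frac{(1-z)^{-1/2}}{{\rm i} t\,\partial F/\partial z}\right){\rm e}^{{\rm i} tF(z;\lambda)}\Bigg|_{z=1-k},$$ where the operator $\big(\frac{-1}{{\rm i} t\,\partial F/\partial z}\cdot\frac{\partial}{\partial z}\big)$ means: differentiate in $z$, then multiply by $-1/({\rm i} t\,\partial F/\partial z)$. $(2j-1)!!$ is the double factorial, with $(-1)!!=1$. $f\ll g$ means $f/g\to0$ as $t\to\infty$. *)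

theory Defs
  imports "HOL-Analysis.Analysis"
begin

text \<open>Double factorial on naturals; dfact 0 = 1 (used for (-1)!! = 1 via 2*0-1 = 0 in nat).\<close>
fun dfact :: "nat \<Rightarrow> nat" where
  "dfact 0 = 1"
| "dfact (Suc 0) = 1"
| "dfact (Suc (Suc n)) = Suc (Suc n) * dfact n"

text \<open>F(z;lambda) with principal logarithms: Ln(1-z) has cut [1,inf), Ln z has cut (-inf,0].\<close>
definition Fz :: "complex \<Rightarrow> real \<Rightarrow> complex" where
  "Fz z lam = (1 - z) * Ln (1 - z) + z * Ln z + z * of_real (ln lam)"

definition dFz :: "complex \<Rightarrow> real \<Rightarrow> complex" where
  "dFz z lam = Ln (z * of_real lam / (1 - z))"

definition phi_adm :: "real \<Rightarrow> real \<Rightarrow> bool" where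
  "phi_adm lam phi \<longleftrightarrow>
     (if ln lam \<ge> 0 then 0 < phi \<and> phi < pi / 2
      else 0 < phi \<and> phi < arctan (pi / \<bar>ln lam\<bar>))"

definition JB :: "real \<Rightarrow> real \<Rightarrow> real \<Rightarrow> real \<Rightarrow> complex" where
  "JB \<delta> t lam phi =
     integral {0..} (\<lambda>s::real.
        let z = of_real (1 - t powr (\<delta> - 1)) + of_real s * cis phi
        in (1 - z) powr (-1/2) * exp (\<i> * of_real t * Fz z lam) * cis phi)"

fun Top :: "nat \<Rightarrow> real \<Rightarrow> real \<Rightarrow> complex \<Rightarrow> complex" where
  "Top 0 t lam = (\<lambda>z. (1 - z) powr (-1/2) / (\<i> * of_real t * dFz z lam))"
| "Top (Suc j) t lam = (\<lambda>z. - 1 / (\<i> * of_real t * dFz z lam) * deriv (Top j t lam) z)"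

definition Tj :: "nat \<Rightarrow> real \<Rightarrow> real \<Rightarrow> real \<Rightarrow> complex" where
  "Tj j t lam k = - (Top j t lam (of_real (1 - k)) * exp (\<i> * of_real t * Fz (of_real (1 - k)) lam))"

end

theory Submission
  imports Defs "HOL-Complex_Analysis.Complex_Analysis"
begin

text \<open>
  Write \<open>\<kappa> = t powr (\<delta> - 1)\<close>, so that the left endpoint is \<open>1 - \<kappa>\<close>, and rescale by \<open>z = 1 - \<kappa> + \<kappa> v\<close>;
  the large parameter becomes \<open>t \<kappa> = t powr \<delta>\<close>. The integrand is holomorphic on the plane slit along
  \<open>(-\<infinity>, 0]\<close> and \<open>[1, \<infinity>)\<close>, which is starlike, so it has a primitive \<open>P\<close> there and every contour is
  handled through differences of \<open>P\<close>. The ray is replaced by the path from \<open>v = 0\<close> along the real axis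
  to \<open>v = a\<close>, then diagonally to \<open>a + (1 + \<i>)/4\<close>, then horizontally to infinity. On the real piece
  the phase agrees with its quadratic Taylor polynomial up to \<open>t \<kappa> v\<^sup>3\<close>, which gives the Fresnel
  integral. On the diagonal, \<open>Re (dFz z lam)\<close> is bounded below by a multiple of \<open>Re v\<close> uniformly in \<open>lam\<close>, so repeated
  integration by parts yields the boundary terms, and Cauchy's inequality bounds all derivatives. On the
  horizontal piece \<open>Im (dFz z lam) \<ge> 1/4\<close>, so its contribution is exponentially small. One step of
  integration by parts more than required is made, since the remainder is then bounded by absolute
  values alone; the extra term is absorbed by the error because \<open>a \<le> t powr (-\<delta>/2 + \<delta>/(4m - 2))\<close>.
\<close>

section \<open>The slit plane and integration by parts\<close>

text \<open>The complement of both branch cuts, given by coordinates so that membership of an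
  explicit contour point is a real inequality.\<close>

definition slit_plane :: "complex set" where
  "slit_plane = {z. Im z \<noteq> 0 \<or> (0 < Re z \<and> Re z < 1)}"

lemma slit_plane_not_nonpos:
  assumes "z \<in> slit_plane"
  shows "z \<notin> \<real>\<^sub>\<le>\<^sub>0" "1 - z \<notin> \<real>\<^sub>\<le>\<^sub>0" "z \<noteq> 0" "1 - z \<noteq> 0"
  using assms by (auto simp: slit_plane_def complex_nonpos_Reals_iff complex_eq_iff)

lemma slit_plane_eq: "slit_plane = - (\<real>\<^sub>\<le>\<^sub>0) \<inter> (\<lambda>z. 1 - z) -` (- (\<real>\<^sub>\<le>\<^sub>0))"
  by (auto simp: slit_plane_def complex_nonpos_Reals_iff)

lemma open_slit_plane: "open slit_plane"
  unfolding slit_plane_eq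
  by (intro open_Int open_vimage open_Compl closed_nonpos_Reals_complex continuous_intros)

text \<open>The star centre is 1/2: a segment from there to a non-real point leaves the real axis at
  once, and one to a real point stays in (0, 1). This yields both connectedness and global
  primitives.\<close>

lemma starlike_slit_plane: "starlike slit_plane"
  unfolding starlike_def
proof (intro bexI ballI subsetI)
  show half: "1/2 \<in> slit_plane"
    by (simp add: slit_plane_def)
  fix x y :: complex
  assume x: "x \<in> slit_plane" and "y \<in> closed_segment (1/2) x"
  then obtain u where u: "0 \<le> u" "u \<le> 1" and y: "y = (1 - u) *\<^sub>R (1/2) + u *\<^sub>R x"
    by (auto simp: in_segment)
  show "y \<in> slit_plane"
  proof (cases "u = 0 \<or> Im x \<noteq> 0")
    case True
    then show ?thesis using half by (auto simp: y slit_plane_def)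
  next
    case False
    with x have "0 < Re x" "Re x < 1" by (auto simp: slit_plane_def)
    then have "0 < u * Re x" "u * Re x < u"
      using u False mult_strict_left_mono[of "Re x" 1 u] by auto
    then have "0 < (1 - u) / 2 + u * Re x" "(1 - u) / 2 + u * Re x < 1"
      using u unfolding diff_divide_distrib by linarith+
    then show ?thesis by (auto simp: y slit_plane_def)
  qed
qed

text \<open>If the quotient equals \<open>r \<le> 0\<close> then \<open>z * (lam + r) = r\<close>.
  Either z is real in (0, 1), where the quotient is positive, or \<open>lam + r = 0\<close>, which
  forces \<open>r = 0\<close> and hence \<open>lam = 0\<close>.\<close>

lemma slit_ratio_not_nonpos:
  assumes z: "z \<in> slit_plane" and lam: "lam > 0"
  shows "z * of_real lam / (1 - z) \<notin> \<real>\<^sub>\<le>\<^sub>0"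
proof
  assume "z * of_real lam / (1 - z) \<in> \<real>\<^sub>\<le>\<^sub>0"
  then obtain r where r: "r \<le> 0" "z * of_real lam / (1 - z) = of_real r"
    by (auto elim!: nonpos_Reals_cases)
  then have eq: "z * of_real lam = of_real r * (1 - z)"
    using slit_plane_not_nonpos[OF z] by (simp add: field_simps)
  have im: "Im z * (lam + r) = 0" and re: "Re z * (lam + r) = r"
    using arg_cong[OF eq, of Im] arg_cong[OF eq, of Re] by (simp_all add: algebra_simps)
  show False
  proof (cases "Im z = 0")
    case True
    then have x: "0 < Re z" "Re z < 1" using z by (auto simp: slit_plane_def)
    have "0 < Re z * lam" using x lam by simp
    also have "\<dots> = r * (1 - Re z)" using re by (simp add: algebra_simps)
    also have "\<dots> \<le> 0" using x r by (intro mult_nonpos_nonneg) auto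
    finally show False by simp
  next
    case False
    then have "lam + r = 0" using im by simp
    then show False using re lam by simp
  qed
qed

text \<open>Splitting the logarithm of a quotient may cost a multiple of 2 pi \<i>. Here it does
  not, because both sides have derivative 1/z + 1/(1 - z) on a connected set and agree at
  1/2.\<close>

lemma dFz_eq:
  assumes z: "z \<in> slit_plane" and lam: "lam > 0"
  shows "dFz z lam = Ln z - Ln (1 - z) + of_real (ln lam)"
proof -
  define g where "g z = dFz z lam - (Ln z - Ln (1 - z) + of_real (ln lam))" for z
  have der: "(g has_field_derivative 0) (at w)" if w: "w \<in> slit_plane" for w
  proof -
    note nz = slit_plane_not_nonpos[OF w] slit_ratio_not_nonpos[OF w lam]
    have "((\<lambda>w. w * of_real lam / (1 - w)) has_field_derivative of_real lam / (1 - w)\<^sup>2) (at w)"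
      by (rule derivative_eq_intros refl nz)+ (use nz in \<open>simp add: power2_eq_square algebra_simps\<close>)
    from DERIV_chain2[OF has_field_derivative_Ln[OF nz(5)] this]
    have "((\<lambda>w. Ln (w * of_real lam / (1 - w))) has_field_derivative
      inverse (w * of_real lam / (1 - w)) * (of_real lam / (1 - w)\<^sup>2)) (at w)"
      by simp
    moreover have "inverse (w * of_real lam / (1 - w)) * (of_real lam / (1 - w)\<^sup>2) = inverse w + inverse (1 - w)"
      using nz lam by (simp add: divide_simps power2_eq_square)
    ultimately have "((\<lambda>w. dFz w lam) has_field_derivative inverse w + inverse (1 - w)) (at w)"
      unfolding dFz_def by (simp only:)
    moreover have "((\<lambda>w. Ln w - Ln (1 - w) + of_real (ln lam)) has_field_derivative
      inverse w + inverse (1 - w)) (at w)"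
      using nz by (auto intro!: derivative_eq_intros)
    ultimately have "(g has_field_derivative (inverse w + inverse (1 - w)) - (inverse w + inverse (1 - w))) (at w)"
      unfolding g_def by (rule DERIV_diff)
    then show ?thesis by simp
  qed
  have "g constant_on slit_plane"
    using der starlike_imp_connected[OF starlike_slit_plane] open_slit_plane
    by (rule has_field_derivative_0_imp_constant_on)
  moreover have "1/2 \<in> slit_plane" by (simp add: slit_plane_def)
  ultimately have "g z = g (1/2)"
    using z unfolding constant_on_def by metis
  also have "\<dots> = 0"
    using lam by (simp add: g_def dFz_def Ln_of_real)
  finally show ?thesis by (simp add: g_def)
qed

lemma Fz_has_field_derivative:
  assumes z: "z \<in> slit_plane" and lam: "lam > 0"
  shows "((\<lambda>z. Fz z lam) has_field_derivative dFz z lam) (at z)"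
proof -
  have "1 + z * inverse (1 - z) = inverse (1 - z)"
    using slit_plane_not_nonpos[OF z] by (simp add: field_simps)
  then show ?thesis
    unfolding Fz_def dFz_eq[OF assms] using slit_plane_not_nonpos[OF z]
    by (auto intro!: derivative_eq_intros simp: algebra_simps)
qed

text \<open>The integrand of \<open>JB\<close> in the complex variable, without the factor
  \<open>cis phi\<close> that comes from parametrising the ray.\<close>

definition JBf :: "real \<Rightarrow> real \<Rightarrow> complex \<Rightarrow> complex" where
  "JBf t lam z = (1 - z) powr (-1/2) * exp (\<i> * of_real t * Fz z lam)"

lemma exp_Fz_has_field_derivative:
  assumes z: "z \<in> slit_plane" and lam: "lam > 0"
  shows "((\<lambda>z. exp (\<i> * of_real t * Fz z lam)) has_field_derivative
    \<i> * of_real t * dFz z lam * exp (\<i> * of_real t * Fz z lam)) (at z)"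
  by (rule derivative_eq_intros Fz_has_field_derivative[OF assms] refl)+ (simp add: algebra_simps)

lemma JBf_holomorphic:
  assumes lam: "lam > 0"
  shows "JBf t lam holomorphic_on slit_plane"
proof -
  have "(\<lambda>z. exp (\<i> * of_real t * Fz z lam)) holomorphic_on slit_plane"
    using exp_Fz_has_field_derivative[OF _ lam, of _ t] open_slit_plane
    by (auto simp: holomorphic_on_open)
  moreover have "(\<lambda>z. (1 - z) powr (-1/2)) holomorphic_on slit_plane"
    using slit_plane_not_nonpos by (intro holomorphic_intros) auto
  ultimately show ?thesis
    unfolding JBf_def[abs_def] by (rule holomorphic_on_mult[rotated])
qed

lemma JBf_primitive:
  assumes lam: "lam > 0"
  obtains P where "\<And>z. z \<in> slit_plane \<Longrightarrow> (P has_field_derivative JBf t lam z) (at z)"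
proof -
  have "\<exists>g. \<forall>x \<in> slit_plane. (g has_field_derivative JBf t lam x) (at x)"
    using JBf_holomorphic[OF lam] open_slit_plane
    by (intro holomorphic_starlike_primitive[of _ _ "{}"] starlike_slit_plane)
      (auto intro: holomorphic_on_imp_continuous_on holomorphic_on_imp_differentiable_at)
  with that show ?thesis by blast
qed

section \<open>Boundary terms of the repeated integration by parts\<close>

definition dFz_regular :: "real \<Rightarrow> complex set" where
  "dFz_regular lam = {z \<in> slit_plane. dFz z lam \<noteq> 0}"

lemma dFz_holomorphic: "lam > 0 \<Longrightarrow> (\<lambda>z. dFz z lam) holomorphic_on slit_plane"
  unfolding dFz_def using slit_plane_not_nonpos slit_ratio_not_nonpos
  by (intro holomorphic_intros) auto

lemma open_dFz_regular:
  assumes "lam > 0"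
  shows "open (dFz_regular lam)"
proof -
  have "dFz_regular lam = {z \<in> slit_plane. dFz z lam \<in> - {0}}"
    by (auto simp: dFz_regular_def)
  also have "open \<dots>"
    using continuous_openin_preimage_gen[of slit_plane "\<lambda>z. dFz z lam" "- {0}"]
      holomorphic_on_imp_continuous_on[OF dFz_holomorphic[OF assms]] open_slit_plane
    by (simp add: vimage_def Int_def openin_open_eq open_Compl)
  finally show ?thesis .
qed

lemma Top_holomorphic:
  assumes lam: "lam > 0" and t: "t > 0"
  shows "Top j t lam holomorphic_on dFz_regular lam"
proof (induction j)
  case 0
  show ?case
    unfolding Top.simps dFz_def using slit_plane_not_nonpos slit_ratio_not_nonpos lam t
    by (intro holomorphic_intros) (auto simp: dFz_regular_def dFz_def)
next
  case (Suc j)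
  have "(\<lambda>z. dFz z lam) holomorphic_on dFz_regular lam"
    by (rule holomorphic_on_subset[OF dFz_holomorphic[OF lam]]) (auto simp: dFz_regular_def)
  then show ?case
    unfolding Top.simps using t
    by (intro holomorphic_intros Suc open_dFz_regular lam) (auto simp: dFz_regular_def)
qed

text \<open>The boundary term as a function of the point. \<open>Tj\<close> is its negative at
  \<open>1 - k\<close>, which is a lower endpoint of integration.\<close>

definition Sj :: "nat \<Rightarrow> real \<Rightarrow> real \<Rightarrow> complex \<Rightarrow> complex" where
  "Sj j t lam z = Top j t lam z * exp (\<i> * of_real t * Fz z lam)"

text \<open>By the recursion for \<open>Top\<close>, the derivative of \<open>Top j\<close> is
  \<open>- \<i> * t * dFz\<close> times \<open>Top (Suc j)\<close>, so the product rule gives a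
  difference of consecutive terms and sums over j telescope.\<close>

lemma Sj_has_field_derivative:
  assumes z: "z \<in> dFz_regular lam" and lam: "lam > 0" and t: "t > 0"
  shows "(Sj j t lam has_field_derivative
    \<i> * of_real t * dFz z lam * (Top j t lam z - Top (Suc j) t lam z)
      * exp (\<i> * of_real t * Fz z lam)) (at z)"
proof -
  have T: "(Top j t lam has_field_derivative deriv (Top j t lam) z) (at z)"
    using Top_holomorphic[OF lam t] open_dFz_regular[OF lam] z by (rule holomorphic_derivI)
  have z': "z \<in> slit_plane" "dFz z lam \<noteq> 0"
    using z by (auto simp: dFz_regular_def)
  have D: "(Sj j t lam has_field_derivative Top j t lam z *
      (\<i> * of_real t * dFz z lam * exp (\<i> * of_real t * Fz z lam)) +
      deriv (Top j t lam) z * exp (\<i> * of_real t * Fz z lam)) (at z)"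
    unfolding Sj_def by (rule DERIV_mult'[OF T exp_Fz_has_field_derivative[OF z'(1) lam]])
  show ?thesis
    by (rule DERIV_cong[OF D]) (use z'(2) t in \<open>simp add: field_simps\<close>)
qed

text \<open>Integration by parts in differential form: after subtracting \<open>N\<close> boundary terms, the
  remaining integrand is that of the \<open>N\<close>-th derivative step.\<close>
lemma primitive_minus_Sj_has_field_derivative:
  assumes z: "z \<in> dFz_regular lam" and lam: "lam > 0" and t: "t > 0"
    and P: "(P has_field_derivative JBf t lam z) (at z)"
  shows "((\<lambda>z. P z - (\<Sum>j<Suc N. Sj j t lam z)) has_field_derivative
    - (deriv (Top N t lam) z * exp (\<i> * of_real t * Fz z lam))) (at z)"
proof -
  define E where "E = exp (\<i> * of_real t * Fz z lam)"
  have nz: "dFz z lam \<noteq> 0"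
    using z by (auto simp: dFz_regular_def)
  have "((\<lambda>z. P z - (\<Sum>j<Suc N. Sj j t lam z)) has_field_derivative
    JBf t lam z - (\<Sum>j<Suc N. \<i> * of_real t * dFz z lam * (Top j t lam z - Top (Suc j) t lam z) * E)) (at z)"
    unfolding E_def by (intro DERIV_diff P DERIV_sum Sj_has_field_derivative z lam t)
  also have "(\<Sum>j<Suc N. \<i> * of_real t * dFz z lam * (Top j t lam z - Top (Suc j) t lam z) * E)
    = \<i> * of_real t * dFz z lam * (\<Sum>j<Suc N. Top j t lam z - Top (Suc j) t lam z) * E"
    by (simp only: sum_distrib_left sum_distrib_right)
  also have "(\<Sum>j<Suc N. Top j t lam z - Top (Suc j) t lam z) = Top 0 t lam z - Top (Suc N) t lam z"
    by (rule sum_lessThan_telescope')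
  also have "JBf t lam z - \<i> * of_real t * dFz z lam * (Top 0 t lam z - Top (Suc N) t lam z) * E
    = - (deriv (Top N t lam) z * E)"
    using nz t by (simp add: JBf_def E_def field_simps)
  finally show ?thesis unfolding E_def .
qed

section \<open>Bounds for the iterated terms\<close>

lemma norm_powr_minus_half:
  fixes w :: complex
  shows "norm (w powr (-1/2)) = norm w powr (-1/2)"
proof -
  have "(-1/2::complex) \<in> \<real>"
    by (metis Reals_of_real of_real_minus of_real_1 of_real_divide of_real_numeral)
  from norm_powr_real_powr'[OF this, of w] show ?thesis by simp
qed

text \<open>\<open>sqrt \<kappa> / \<kappa>\<close> is the power -1/2 of \<kappa>, written so that a
  factor \<open>sqrt \<kappa>\<close> can be carried through all later bounds.\<close>

lemma norm_powr_minus_half_le: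
  fixes w :: complex
  assumes "\<kappa> > 0" "\<kappa> / 4 \<le> norm w"
  shows "norm (w powr (-1/2)) \<le> 2 * sqrt \<kappa> / \<kappa>"
proof -
  have "norm w powr (-1/2) \<le> (\<kappa> / 4) powr (-1/2)"
    using assms by (intro powr_mono2') auto
  also have "\<dots> = inverse (sqrt \<kappa> / 2)"
    using assms powr_minus[of "\<kappa>/4" "1/2"] by (simp add: powr_half_sqrt real_sqrt_divide)
  also have "\<dots> = 2 * sqrt \<kappa> / \<kappa>"
    using assms real_div_sqrt[of \<kappa>] by (simp add: divide_simps)
  finally show ?thesis by (simp only: norm_powr_minus_half)
qed

text \<open>Cauchy's inequality on the disc of radius \<open>\<rho>/2\<close> about z; its closure
  still lies in the ball of radius \<open>2 * \<rho>\<close> about p.\<close>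

lemma norm_deriv_le_ball:
  assumes hol: "f holomorphic_on ball p (2 * \<rho>)" and \<rho>: "\<rho> > 0" and z: "z \<in> ball p \<rho>"
    and B: "\<And>w. w \<in> ball p (2 * \<rho>) \<Longrightarrow> norm (f w) \<le> B"
  shows "norm (deriv f z) \<le> 2 * B / \<rho>"
proof -
  have cb: "cball z (\<rho>/2) \<subseteq> ball p (2 * \<rho>)"
  proof
    fix w assume "w \<in> cball z (\<rho>/2)"
    then show "w \<in> ball p (2 * \<rho>)"
      using z \<rho> dist_triangle[of p w z] by (auto simp: dist_commute)
  qed
  have "norm ((deriv ^^ 1) f z) \<le> fact 1 * B / (\<rho>/2) ^ 1"
  proof (rule Cauchy_inequality)
    show "f holomorphic_on ball z (\<rho>/2)"
      by (rule holomorphic_on_subset[OF hol order.trans[OF ball_subset_cball cb]])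
    show "continuous_on (cball z (\<rho>/2)) f"
      by (rule holomorphic_on_imp_continuous_on[OF holomorphic_on_subset[OF hol cb]])
    fix x assume "norm (z - x) = \<rho>/2"
    then have "x \<in> cball z (\<rho>/2)" by (simp add: dist_norm)
    with cb show "norm (f x) \<le> B" by (intro B) auto
  qed (use \<rho> in auto)
  then show ?thesis by (simp add: mult.commute)
qed

text \<open>Each step in j halves the ball. The derivative costs 1/(\<kappa> r) by Cauchy and the
  division by \<open>t * dFz\<close> another 1/(t r), so a step costs a constant times 1/(t \<kappa>
  r^2). \<open>C\<close> is chosen before all parameters, hence depends on j alone; uniformity in
  \<open>lam\<close> rests on this.\<close>

lemma Top_bound:
  "\<exists>C\<ge>0. \<forall>t>0. \<forall>\<kappa>>0. \<forall>r>0. \<forall>lam>0. \<forall>p.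
    ball p (\<kappa> * r / 4) \<subseteq> slit_plane \<longrightarrow>
    (\<forall>z\<in>ball p (\<kappa> * r / 4). \<kappa> / 4 \<le> norm (1 - z) \<and> r / 8 \<le> norm (dFz z lam)) \<longrightarrow>
    (\<forall>z\<in>ball p (\<kappa> * r / 4 / 2 ^ j).
      norm (Top j t lam z) \<le> C * sqrt \<kappa> / ((t * \<kappa>) ^ (j + 1) * r ^ (2 * j + 1)))"
proof (induction j)
  case 0
  show ?case
  \<comment> \<open>16 is the 2 of \<open>norm_powr_minus_half_le\<close> times the 8 of
    \<open>r / 8\<close>.\<close>
  proof (intro exI[of _ 16] conjI allI impI ballI)
    fix t \<kappa> r lam :: real and p z :: complex
    assume pos: "t > 0" "\<kappa> > 0" "r > 0"
      and *: "\<forall>z\<in>ball p (\<kappa> * r / 4). \<kappa> / 4 \<le> norm (1 - z) \<and> r / 8 \<le> norm (dFz z lam)"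
      and "z \<in> ball p (\<kappa> * r / 4 / 2 ^ 0)"
    then have z: "\<kappa> / 4 \<le> norm (1 - z)" "r / 8 \<le> norm (dFz z lam)" by auto
    have p: "norm ((1 - z) powr (-1/2)) \<le> 2 * sqrt \<kappa> / \<kappa>"
      using z pos by (intro norm_powr_minus_half_le) auto
    have "norm (Top 0 t lam z) = norm ((1 - z) powr (-1/2)) / (t * norm (dFz z lam))"
      using pos by (simp add: norm_divide norm_mult)
    also have "\<dots> \<le> (2 * sqrt \<kappa> / \<kappa>) / (t * (r / 8))"
      using p z pos by (intro frac_le mult_left_mono) auto
    also have "\<dots> = 16 * sqrt \<kappa> / ((t * \<kappa>) ^ (0 + 1) * r ^ (2 * 0 + 1))"
      using pos by (simp add: divide_simps)
    finally show "norm (Top 0 t lam z) \<le> 16 * sqrt \<kappa> / ((t * \<kappa>) ^ (0 + 1) * r ^ (2 * 0 + 1))" .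
  qed auto
next
  case (Suc j)
  then obtain C where C: "C \<ge> 0" and IH: "\<And>t \<kappa> r lam p z. t > 0 \<Longrightarrow> \<kappa> > 0 \<Longrightarrow> r > 0 \<Longrightarrow> lam > 0 \<Longrightarrow>
    ball p (\<kappa> * r / 4) \<subseteq> slit_plane \<Longrightarrow>
    \<forall>z\<in>ball p (\<kappa> * r / 4). \<kappa> / 4 \<le> norm (1 - z) \<and> r / 8 \<le> norm (dFz z lam) \<Longrightarrow>
    z\<in>ball p (\<kappa> * r / 4 / 2 ^ j) \<Longrightarrow>
      norm (Top j t lam z) \<le> C * sqrt \<kappa> / ((t * \<kappa>) ^ (j + 1) * r ^ (2 * j + 1))"
    by metis
  show ?case
  \<comment> \<open>Cauchy with \<open>\<rho> = \<kappa> * r / (8 * 2 ^ j)\<close> contributes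
    \<open>16 * 2 ^ j\<close>, and the lower bound \<open>r / 8\<close> contributes 8.\<close>
  proof (intro exI[of _ "128 * 2 ^ j * C"] conjI allI impI ballI)
    fix t \<kappa> r lam :: real and p z :: complex
    assume pos: "t > 0" "\<kappa> > 0" "r > 0" "lam > 0"
      and sub: "ball p (\<kappa> * r / 4) \<subseteq> slit_plane"
      and low: "\<forall>z\<in>ball p (\<kappa> * r / 4). \<kappa> / 4 \<le> norm (1 - z) \<and> r / 8 \<le> norm (dFz z lam)"
      and z: "z \<in> ball p (\<kappa> * r / 4 / 2 ^ Suc j)"
    define B where "B = C * sqrt \<kappa> / ((t * \<kappa>) ^ (j + 1) * r ^ (2 * j + 1))"
    define \<rho> where "\<rho> = \<kappa> * r / 4 / 2 ^ Suc j"
    have \<rho>: "\<rho> > 0" "\<rho> + \<rho> = \<kappa> * r / 4 / 2 ^ j"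
      using pos by (simp_all add: \<rho>_def field_simps)
    have "(1::real) \<le> 2 ^ Suc j" by (rule one_le_power) simp
    then have \<rho>3: "\<rho> \<le> \<kappa> * r / 4"
      using pos by (simp add: \<rho>_def field_simps)
    have reg: "ball p (\<kappa> * r / 4) \<subseteq> dFz_regular lam"
      using sub low pos by (fastforce simp: dFz_regular_def)
    have le: "\<kappa> * r / 4 / 2 ^ j \<le> \<kappa> * r / 4"
      using pos by (simp add: field_simps)
    have zin: "z \<in> ball p (\<kappa> * r / 4)"
      using z \<rho>3 unfolding \<rho>_def[symmetric] by auto
    have "norm (deriv (Top j t lam) z) \<le> 2 * B / \<rho>"
    proof (rule norm_deriv_le_ball)
      show "Top j t lam holomorphic_on ball p (2 * \<rho>)"
        using \<rho> le by (intro holomorphic_on_subset[OF Top_holomorphic[OF pos(4,1)] order.trans[OF _ reg]] subset_ball)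
          simp
      show "norm (Top j t lam w) \<le> B" if "w \<in> ball p (2 * \<rho>)" for w
        unfolding B_def by (intro IH[OF pos sub low]) (use that \<rho> in simp)
    qed (use \<rho> z in \<open>simp_all add: \<rho>_def\<close>)
    then have d: "norm (deriv (Top j t lam) z) \<le> B * 2 / \<rho>" by (simp add: mult.commute)
    have "norm (Top (Suc j) t lam z) = norm (deriv (Top j t lam) z) / (t * norm (dFz z lam))"
      using pos by (simp add: norm_mult norm_divide)
    also have "\<dots> \<le> (B * 2 / \<rho>) / (t * (r / 8))"
      using zin low pos d order_trans[OF norm_ge_zero d] by (intro frac_le mult_left_mono) auto
    also have "\<dots> = 128 * 2 ^ j * C * sqrt \<kappa> / ((t * \<kappa>) ^ (Suc j + 1) * r ^ (2 * Suc j + 1))"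
    proof -
      have *: "(t * \<kappa>) ^ (Suc j + 1) = t * \<kappa> * (t * \<kappa>) ^ (j + 1)"
        "r ^ (2 * Suc j + 1) = r * r * r ^ (2 * j + 1)" "2 ^ Suc j = 2 * (2::real) ^ j"
        by simp_all
      have "(C * s / (A * D) * 2 / (\<kappa> * r / 4 / (2 * p))) / (t * (r / 8))
          = 128 * p * C * s / ((t * \<kappa> * A) * (r * r * D))" if "A > 0" "D > 0" for s A D p
        using pos that by (simp add: divide_simps)
      then show ?thesis
        unfolding B_def \<rho>_def * using pos by simp
    qed
    finally show "norm (Top (Suc j) t lam z)
      \<le> 128 * 2 ^ j * C * sqrt \<kappa> / ((t * \<kappa>) ^ (Suc j + 1) * r ^ (2 * Suc j + 1))" .
  qed (use C in auto)
qed

text \<open>Only the centre matters, as every point of the diagonal gets its own ball. The last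
  derivative is not divided by \<open>dFz\<close>, so a single \<kappa> and an even power of r
  appear in the denominator.\<close>

lemma deriv_Top_bound:
  "\<exists>C\<ge>0. \<forall>t>0. \<forall>\<kappa>>0. \<forall>r>0. \<forall>lam>0. \<forall>p.
    ball p (\<kappa> * r / 4) \<subseteq> slit_plane \<longrightarrow>
    (\<forall>z\<in>ball p (\<kappa> * r / 4). \<kappa> / 4 \<le> norm (1 - z) \<and> r / 8 \<le> norm (dFz z lam)) \<longrightarrow>
    norm (deriv (Top j t lam) p) \<le> C * sqrt \<kappa> / ((t * \<kappa>) ^ (j + 1) * \<kappa> * r ^ (2 * j + 2))"
proof -
  obtain C where C: "C \<ge> 0" and bnd: "\<And>t \<kappa> r lam p z. t > 0 \<Longrightarrow> \<kappa> > 0 \<Longrightarrow> r > 0 \<Longrightarrow> lam > 0 \<Longrightarrow>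
    ball p (\<kappa> * r / 4) \<subseteq> slit_plane \<Longrightarrow>
    \<forall>z\<in>ball p (\<kappa> * r / 4). \<kappa> / 4 \<le> norm (1 - z) \<and> r / 8 \<le> norm (dFz z lam) \<Longrightarrow>
    z\<in>ball p (\<kappa> * r / 4 / 2 ^ j) \<Longrightarrow>
      norm (Top j t lam z) \<le> C * sqrt \<kappa> / ((t * \<kappa>) ^ (j + 1) * r ^ (2 * j + 1))"
    using Top_bound[of j] by metis
  show ?thesis
  proof (intro exI[of _ "16 * 2 ^ j * C"] conjI allI impI)
    fix t \<kappa> r lam :: real and p :: complex
    assume pos: "t > 0" "\<kappa> > 0" "r > 0" "lam > 0"
      and sub: "ball p (\<kappa> * r / 4) \<subseteq> slit_plane"
      and low: "\<forall>z\<in>ball p (\<kappa> * r / 4). \<kappa> / 4 \<le> norm (1 - z) \<and> r / 8 \<le> norm (dFz z lam)"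
    define \<rho> where "\<rho> = \<kappa> * r / (8 * 2 ^ j)"
    have \<rho>: "\<rho> > 0" "2 * \<rho> = \<kappa> * r / 4 / 2 ^ j"
      using pos by (simp_all add: \<rho>_def)
    have reg: "ball p (\<kappa> * r / 4) \<subseteq> dFz_regular lam"
      using sub low pos by (fastforce simp: dFz_regular_def)
    have le: "\<kappa> * r / 4 / 2 ^ j \<le> \<kappa> * r / 4"
      using pos by (simp add: field_simps)
    have "norm (deriv (Top j t lam) p)
      \<le> 2 * (C * sqrt \<kappa> / ((t * \<kappa>) ^ (j + 1) * r ^ (2 * j + 1))) / \<rho>"
    proof (rule norm_deriv_le_ball)
      show "Top j t lam holomorphic_on ball p (2 * \<rho>)"
        using \<rho> le by (intro holomorphic_on_subset[OF Top_holomorphic[OF pos(4,1)] order.trans[OF _ reg]] subset_ball)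
          simp
    qed (use \<rho> bnd[OF pos sub low] in auto)
    also have "\<dots> = 16 * 2 ^ j * C * sqrt \<kappa> / ((t * \<kappa>) ^ (j + 1) * \<kappa> * r ^ (2 * j + 2))"
    proof -
      have *: "r ^ (2 * j + 2) = r * r ^ (2 * j + 1)" by simp
      have "2 * (C * s / (A * D)) / (\<kappa> * r / (8 * p)) = 16 * p * C * s / (A * \<kappa> * (r * D))"
        if "A > 0" "D > 0" for s A D p
        using pos that by (simp add: divide_simps)
      then show ?thesis unfolding * \<rho>_def using pos by simp
    qed
    finally show "norm (deriv (Top j t lam) p)
      \<le> 16 * 2 ^ j * C * sqrt \<kappa> / ((t * \<kappa>) ^ (j + 1) * \<kappa> * r ^ (2 * j + 2))" .
  qed (use C in auto)
qed

section \<open>Lower bounds for \<open>dFz\<close> near the contour\<close>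

lemma norm_slit_ratio_ge:
  fixes v :: complex
  assumes \<kappa>: "0 < \<kappa>" "\<kappa> < 1" and lam: "\<kappa> / (1 - \<kappa>) \<le> lam"
    and v: "0 \<le> Re v" "v \<noteq> 1" and z: "z = of_real (1 - \<kappa>) + of_real \<kappa> * v"
  shows "1 / norm (1 - v) \<le> norm (z * of_real lam / (1 - z))"
proof -
  have lam': "\<kappa> \<le> (1 - \<kappa>) * lam" using lam \<kappa> by (simp add: field_simps)
  have z1: "1 - z = of_real \<kappa> * (1 - v)" by (simp add: z algebra_simps)
  have pos: "lam > 0" using lam \<kappa> by (smt (verit) divide_pos_pos)
  have "1 - \<kappa> \<le> Re z" using v \<kappa> by (simp add: z)
  also have "\<dots> \<le> norm z" by (rule complex_Re_le_cmod)
  \<comment> \<open>The lower bound on \<open>lam\<close> compensates the factor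
    \<open>1 - \<kappa>\<close>, so that |z| lam is at least \<kappa>, the scale of |1 - z|.
    Uniformity in \<open>lam\<close> starts here.\<close>
  finally have "(1 - \<kappa>) * lam \<le> norm z * lam" using pos by simp
  with lam' have "\<kappa> \<le> norm z * lam" by simp
  then have "\<kappa> / (\<kappa> * norm (1 - v)) \<le> norm z * lam / (\<kappa> * norm (1 - v))"
    using \<kappa> by (intro divide_right_mono) auto
  then show ?thesis using \<kappa> pos unfolding z1 by (simp add: norm_mult norm_divide)
qed

text \<open>The real part of \<open>Ln\<close> is the logarithm of the modulus, which gives at least
  -ln |1 - v|. Then ln x \<le> x - 1 is applied to x = |1 - v|^2 = 1 - 2 Re v + |v|^2.\<close>

lemma Re_dFz_ge:
  fixes v :: complex
  assumes \<kappa>: "0 < \<kappa>" "\<kappa> < 1" and lam: "\<kappa> / (1 - \<kappa>) \<le> lam"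
    and v: "0 \<le> Re v" "v \<noteq> 1" and z: "z = of_real (1 - \<kappa>) + of_real \<kappa> * v"
  shows "Re v - (norm v)\<^sup>2 / 2 \<le> Re (dFz z lam)"
proof -
  note ge = norm_slit_ratio_ge[OF assms]
  have n: "norm (1 - v) > 0" using v by simp
  have w: "0 < norm (z * of_real lam / (1 - z))" using ge n by (smt (verit) divide_pos_pos)
  have "ln ((norm (1 - v))\<^sup>2) \<le> (norm (1 - v))\<^sup>2 - 1"
    using n by (intro ln_le_minus_one) auto
  also have "(norm (1 - v))\<^sup>2 - 1 = (norm v)\<^sup>2 - 2 * Re v"
    unfolding cmod_power2 by (simp add: power2_eq_square algebra_simps)
  finally have "Re v - (norm v)\<^sup>2 / 2 \<le> - ln (norm (1 - v))"
    using n by (simp add: ln_realpow)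
  also have "\<dots> = ln (1 / norm (1 - v))" using n by (simp add: ln_div)
  also have "\<dots> \<le> ln (norm (z * of_real lam / (1 - z)))"
    using ge n w by (simp only: ln_le_cancel_iff divide_pos_pos zero_less_one)
  also have "\<dots> = Re (dFz z lam)"
    unfolding dFz_def using w by (subst Re_Ln) auto
  finally show ?thesis .
qed

text \<open>In the variable v, with r = a + y, the ball has radius r/4 about r + \<i> y, where y
  \<le> r \<le> 3/8. Hence Re v > 3r/4 and |v|^2 \<le> 25 r^2 / 8, so Re v - |v|^2 / 2 is at least
  3r/4 - 75r/128, which exceeds r/8.\<close>

lemma diagonal_ball:
  fixes a y \<kappa> lam :: real and z :: complex
  assumes \<kappa>: "0 < \<kappa>" "\<kappa> < 1" and lam: "\<kappa> / (1 - \<kappa>) \<le> lam"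
    and a: "0 < a" "a \<le> 1/8" and y: "0 \<le> y" "y \<le> 1/4"
    and z: "z \<in> ball (of_real (1 - \<kappa>) + of_real \<kappa> * Complex (a + y) y) (\<kappa> * (a + y) / 4)"
  shows "z \<in> slit_plane" "\<kappa> / 4 \<le> norm (1 - z)" "(a + y) / 8 \<le> Re (dFz z lam)"
proof -
  define v where "v = (z - of_real (1 - \<kappa>)) / of_real \<kappa>"
  have zv: "z = of_real (1 - \<kappa>) + of_real \<kappa> * v" using \<kappa> by (simp add: v_def)
  define r where "r = a + y"
  have r: "0 < r" "r \<le> 3/8" "y \<le> r" using a y by (auto simp: r_def)
  have "\<kappa> * norm (Complex r y - v) < \<kappa> * (r / 4)"
  proof -
    have "of_real \<kappa> * (Complex r y - v) = of_real (1 - \<kappa>) + of_real \<kappa> * Complex (a + y) y - z"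
      by (simp add: zv r_def algebra_simps)
    then have "\<kappa> * norm (Complex r y - v) = norm (of_real (1 - \<kappa>) + of_real \<kappa> * Complex (a + y) y - z)"
      using \<kappa> by (metis abs_of_pos norm_mult norm_of_real)
    then show ?thesis using z by (simp add: dist_norm r_def)
  qed
  then have d: "norm (Complex r y - v) < r / 4" using \<kappa> by simp
  have "\<bar>r - Re v\<bar> < r / 4" "\<bar>y - Im v\<bar> < r / 4"
    using abs_Re_le_cmod[of "Complex r y - v"] abs_Im_le_cmod[of "Complex r y - v"] d by auto
  then have v: "3/4 * r < Re v" "Re v < 5/4 * r" "\<bar>Im v\<bar> < 5/4 * r"
    using r y by (auto simp: abs_if split: if_splits)
  have Re1: "Re v < 1" "0 < Re v" using v r by auto
  then have v1: "v \<noteq> 1" by auto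
  have "\<kappa> * Re v < \<kappa> * 1" using Re1 \<kappa> by (intro mult_strict_left_mono) auto
  moreover have "0 < \<kappa> * Re v" using Re1 \<kappa> by simp
  ultimately show "z \<in> slit_plane" using \<kappa> by (simp add: zv slit_plane_def)
  have "1/4 \<le> 1 - Re v" using v r by simp
  also have "\<dots> \<le> norm (1 - v)" using complex_Re_le_cmod[of "1 - v"] by simp
  finally have "\<kappa> * (1/4) \<le> \<kappa> * norm (1 - v)" using \<kappa> by (intro mult_left_mono) auto
  also have "\<dots> = norm (1 - z)"
  proof -
    have "1 - z = of_real \<kappa> * (1 - v)" by (simp add: zv algebra_simps)
    then show ?thesis using \<kappa> by (simp add: norm_mult)
  qed
  finally show "\<kappa> / 4 \<le> norm (1 - z)" by simp
  have "(Re v)\<^sup>2 \<le> (5/4 * r)\<^sup>2" "(Im v)\<^sup>2 \<le> (5/4 * r)\<^sup>2"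
    using v r power_mono[of "\<bar>Im v\<bar>" "5/4 * r" 2] by (auto intro!: power_mono)
  then have "(norm v)\<^sup>2 \<le> 25/8 * (r * r)"
    unfolding cmod_power2 by (simp add: power2_eq_square)
  moreover have "r * r \<le> r * (3/8)" using r by (intro mult_left_mono) auto
  ultimately have "r / 8 \<le> Re v - (norm v)\<^sup>2 / 2"
    using v r by linarith
  also have "\<dots> \<le> Re (dFz z lam)"
    using Re_dFz_ge[OF \<kappa> lam _ v1 zv] Re1 by simp
  finally show "(a + y) / 8 \<le> Re (dFz z lam)" by (simp add: r_def)
qed

lemma Im_slit_ratio:
  "z \<noteq> 1 \<Longrightarrow> Im (z * of_real lam / (1 - z)) = lam * Im z / (norm (1 - z))\<^sup>2"
  by (simp add: Im_divide cmod_power2 divide_simps) (simp add: algebra_simps)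

text \<open>For positive \<open>lam\<close> the Moebius map z to lam z / (1 - z) preserves the upper
  half plane, where the principal argument is nonnegative.\<close>

lemma Im_dFz_nonneg:
  assumes "z \<in> slit_plane" "0 \<le> Im z" "lam > 0"
  shows "0 \<le> Im (dFz z lam)"
proof -
  have nz: "z \<noteq> 0" "1 - z \<noteq> 0" using slit_plane_not_nonpos[OF assms(1)] by auto
  then have "0 \<le> Im (z * of_real lam / (1 - z))"
    using assms by (subst Im_slit_ratio) auto
  then show ?thesis
    unfolding dFz_def using nz assms Im_Ln_pos_le[of "z * of_real lam / (1 - z)"] by auto
qed

text \<open>In the right half plane |y|^2 \<le> 10 (Im y)^2, so the sine of the argument is at most
  -1/4, and the sine never exceeds a nonnegative angle. In the left half plane the argument is
  already below -pi/2.\<close>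

lemma Im_Ln_le_of_lower:
  assumes "Im y < 0" "Re y \<le> - (3 * Im y)"
  shows "Im (Ln y) \<le> - (1/4)"
proof -
  have y: "y \<noteq> 0" using assms by auto
  have pos: "norm y > 0" using y by simp
  have *: "- pi < Im (Ln y)" "Im (Ln y) < 0"
    using y assms Im_Ln_pos_le[of y] mpi_less_Im_Ln[of y] Im_Ln_le_pi[of y] by auto
  show ?thesis
  proof (cases "0 \<le> Re y")
    case True
    have "(norm y)\<^sup>2 = (Re y)\<^sup>2 + (Im y)\<^sup>2" by (rule cmod_power2)
    also have "(Re y)\<^sup>2 \<le> (3 * Im y)\<^sup>2"
      using assms True power_mono[of "Re y" "- (3 * Im y)" 2] by simp
    finally have "(norm y)\<^sup>2 \<le> 10 * (Im y)\<^sup>2" by (simp add: power_mult_distrib)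
    moreover have "(4 * - Im y)\<^sup>2 = 16 * (Im y)\<^sup>2" "0 \<le> (Im y)\<^sup>2"
      by (simp_all add: power_mult_distrib)
    ultimately have "(norm y)\<^sup>2 \<le> (4 * - Im y)\<^sup>2" by linarith
    then have "norm y \<le> 4 * - Im y"
      by (rule power2_le_imp_le) (use assms in simp)
    then have "Im y / norm y \<le> - (1/4)" using pos by (simp add: field_simps)
    moreover have "Im y / norm y = sin (Im (Ln y))"
      using y pos by (metis exp_Ln Im_exp Re_Ln exp_ln nonzero_mult_div_cancel_left less_irrefl)
    moreover have "sin (- Im (Ln y)) \<le> - Im (Ln y)" using * by (intro sin_x_le_x) auto
    ultimately show ?thesis by simp
  next
    case False
    then have "\<not> \<bar>Im (Ln y)\<bar> \<le> pi / 2" using Re_Ln_pos_le[OF y] by auto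
    then show ?thesis using * pi_gt3 by simp
  qed
qed

section \<open>The diagonal and horizontal pieces\<close>

lemma has_vector_derivative_along_line:
  fixes f :: "complex \<Rightarrow> complex"
  assumes "(f has_field_derivative f') (at (c + of_real x * d))"
  shows "((\<lambda>x. f (c + of_real x * d)) has_vector_derivative d * f') (at x)"
proof -
  have "((\<lambda>x. c + of_real x * d) has_vector_derivative d) (at x)"
    by (auto intro!: derivative_eq_intros)
  from field_vector_diff_chain_at[OF this assms] show ?thesis by (simp add: o_def)
qed

lemma Im_has_real_derivative:
  "(f has_vector_derivative D) (at x) \<Longrightarrow> ((\<lambda>x. Im (f x)) has_real_derivative Im D) (at x)"
  using bounded_linear.has_vector_derivative[OF bounded_linear_Im]
  by (simp add: has_real_derivative_iff_has_vector_derivative)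

lemma Fz_of_real:
  assumes "0 < x" "x < 1"
  shows "Fz (of_real x) lam = of_real ((1 - x) * ln (1 - x) + x * ln x + x * ln lam)"
proof -
  have "Ln (1 - of_real x) = of_real (ln (1 - x))"
    using Ln_of_real[of "1 - x"] assms by simp
  then show ?thesis using assms by (simp add: Fz_def Ln_of_real)
qed

text \<open>The comparison function for the diagonal, where the remainder is dominated by an inverse
  even power of \<open>a + y\<close>.\<close>

lemma minus_inverse_power_has_derivative:
  fixes a y K :: real
  assumes "a + y \<noteq> 0"
  shows "((\<lambda>y. - (K / (a + y) ^ Suc m)) has_real_derivative K * real (Suc m) / (a + y) ^ Suc (Suc m)) (at y)"
proof -
  have "((\<lambda>y. - (K / (a + y) ^ Suc m)) has_real_derivative
    K * (real (Suc m) * (a + y) ^ m) / ((a + y) ^ Suc m * (a + y) ^ Suc m)) (at y)"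
    using assms by (auto intro!: derivative_eq_intros simp del: power_Suc)
  moreover have "K * (real (Suc m) * (a + y) ^ m) / ((a + y) ^ Suc m * (a + y) ^ Suc m)
    = K * real (Suc m) / (a + y) ^ Suc (Suc m)"
    using assms by (simp add: divide_simps)
  ultimately show ?thesis by (simp only:)
qed

text \<open>\<kappa> stands for \<open>t powr (\<delta> - 1)\<close>, so
  \<open>\<kappa> / (1 - \<kappa>)\<close> is the critical value \<lambda>_c. Treating \<kappa>, a
  and t as free numbers keeps asymptotics out of the contour estimates.\<close>

locale steepest =
  fixes \<kappa> lam a t :: real
  assumes \<kappa>: "0 < \<kappa>" "\<kappa> < 1" and lam_ge: "\<kappa> / (1 - \<kappa>) \<le> lam"
    and a: "0 < a" "a \<le> 1/8" and t: "t > 0"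
begin

lemma lam: "lam > 0"
  using lam_ge \<kappa> by (smt (verit) divide_pos_pos)

text \<open>The point a + (1 + \<i>) y in the variable v; it starts on the real axis at 1 - k. The
  affine form matches \<open>has_vector_derivative_along_line\<close>.\<close>

definition diag :: "real \<Rightarrow> complex" where
  "diag y = of_real (1 - \<kappa> + \<kappa> * a) + of_real y * (of_real \<kappa> * (1 + \<i>))"

lemma diag_eq: "diag y = of_real (1 - \<kappa>) + of_real \<kappa> * Complex (a + y) y"
  by (simp add: diag_def complex_eq_iff algebra_simps)

lemma diag_0: "diag 0 = of_real (1 - \<kappa> * (1 - a))"
  by (simp add: diag_def algebra_simps)

lemma diag_ball:
  assumes "0 \<le> y" "y \<le> 1/4"
  shows "ball (diag y) (\<kappa> * (a + y) / 4) \<subseteq> slit_plane"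
    "\<forall>z\<in>ball (diag y) (\<kappa> * (a + y) / 4). \<kappa> / 4 \<le> norm (1 - z) \<and> (a + y) / 8 \<le> norm (dFz z lam)"
    "(a + y) / 8 \<le> Re (dFz (diag y) lam)" "diag y \<in> dFz_regular lam"
proof -
  note D = diagonal_ball[OF \<kappa> lam_ge a assms, folded diag_eq]
  show "ball (diag y) (\<kappa> * (a + y) / 4) \<subseteq> slit_plane"
    using D(1) by auto
  show "\<forall>z\<in>ball (diag y) (\<kappa> * (a + y) / 4). \<kappa> / 4 \<le> norm (1 - z) \<and> (a + y) / 8 \<le> norm (dFz z lam)"
    using D(2,3) order.trans[OF _ complex_Re_le_cmod] by blast
  have c: "diag y \<in> ball (diag y) (\<kappa> * (a + y) / 4)"
    using \<kappa> a assms by simp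
  show R: "(a + y) / 8 \<le> Re (dFz (diag y) lam)" by (rule D(3)[OF c])
  have "0 < (a + y) / 8" using a assms by simp
  with R have "dFz (diag y) lam \<noteq> 0" by (metis less_le_not_le zero_complex.sel(1))
  with D(1)[OF c] show "diag y \<in> dFz_regular lam" by (simp add: dFz_regular_def)
qed

lemma diag_slit: "0 \<le> y \<Longrightarrow> y \<le> 1/4 \<Longrightarrow> diag y \<in> slit_plane"
  using diag_ball(4) by (simp add: dFz_regular_def)

lemma has_vector_derivative_diag:
  assumes "(f has_field_derivative f') (at (diag y))"
  shows "((\<lambda>y. f (diag y)) has_vector_derivative of_real \<kappa> * (1 + \<i>) * f') (at y)"
  using assms unfolding diag_def by (rule has_vector_derivative_along_line)

lemma Im_Fz_real: "0 < x \<Longrightarrow> x < 1 \<Longrightarrow> Im (Fz (of_real x) lam) = 0"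
  by (simp add: Fz_of_real)

lemma diag_0_range: "0 < 1 - \<kappa> * (1 - a)" "1 - \<kappa> * (1 - a) < 1"
proof -
  have "\<kappa> * (1 - a) < 1 * 1" using \<kappa> a by (intro mult_strict_mono') auto
  then show "0 < 1 - \<kappa> * (1 - a)" by simp
  show "1 - \<kappa> * (1 - a) < 1" using \<kappa> a by simp
qed

text \<open>In direction 1 + \<i> the derivative of Im F is \<kappa> (Re dFz + Im dFz). The first
  summand is at least y/8, the second is nonnegative, and F is real at the start; integrating
  \<kappa> y / 8 gives the claim.\<close>

lemma Im_Fz_diag:
  assumes y: "0 \<le> y" "y \<le> 1/4"
  shows "\<kappa> * y\<^sup>2 / 16 \<le> Im (Fz (diag y) lam)"
proof -
  define g where "g y = Im (Fz (diag y) lam) - \<kappa> * y\<^sup>2 / 16" for y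
  have "g 0 \<le> g y"
  proof (rule DERIV_nonneg_imp_nondecreasing[OF y(1)])
    fix x assume x: "0 \<le> x" "x \<le> y"
    then have x': "0 \<le> x" "x \<le> 1/4" using y by auto
    have "(g has_real_derivative Im (of_real \<kappa> * (1 + \<i>) * dFz (diag x) lam) - \<kappa> * x / 8) (at x)"
      unfolding g_def
      by (rule DERIV_diff Im_has_real_derivative has_vector_derivative_diag
          Fz_has_field_derivative diag_slit x' lam)+ (auto intro!: derivative_eq_intros)
    moreover have "0 \<le> Im (of_real \<kappa> * (1 + \<i>) * dFz (diag x) lam) - \<kappa> * x / 8"
    proof -
      have "0 \<le> Im (dFz (diag x) lam)"
        using x' \<kappa> by (intro Im_dFz_nonneg diag_slit lam) (auto simp: diag_def)
      moreover have "x / 8 \<le> Re (dFz (diag x) lam)"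
        using diag_ball(3)[OF x'] a by simp
      ultimately have "\<kappa> * (x / 8) \<le> \<kappa> * (Re (dFz (diag x) lam) + Im (dFz (diag x) lam))"
        using \<kappa> by (intro mult_left_mono) auto
      then show ?thesis by (simp add: algebra_simps)
    qed
    ultimately show "\<exists>D. (g has_real_derivative D) (at x) \<and> 0 \<le> D" by blast
  qed
  moreover have "g 0 = 0"
    unfolding g_def diag_0 using Im_Fz_real[OF diag_0_range] by simp
  ultimately show ?thesis by (simp add: g_def)
qed

lemma norm_exp_Fz: "norm (exp (\<i> * of_real t * Fz z lam)) = exp (- (t * Im (Fz z lam)))"
  by simp

lemma norm_exp_Fz_diag:
  assumes "0 \<le> y" "y \<le> 1/4"
  shows "norm (exp (\<i> * of_real t * Fz (diag y) lam)) \<le> 1"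
proof -
  have "0 \<le> \<kappa> * y\<^sup>2 / 16" using \<kappa> by simp
  also have "\<dots> \<le> Im (Fz (diag y) lam)" by (rule Im_Fz_diag[OF assms])
  finally show ?thesis using t by simp
qed

text \<open>Bounding the exponential by 1 suffices, since the power -(2N + 2) of a + y integrates to
  the power -(2N + 1) of a. The factor 2 bounds |1 + \<i>|.\<close>

lemma primitive_diag_bound:
  assumes P: "\<And>z. z \<in> slit_plane \<Longrightarrow> (P has_field_derivative JBf t lam z) (at z)"
    and C: "C \<ge> 0"
    and bnd: "\<And>y. 0 \<le> y \<Longrightarrow> y \<le> 1/4 \<Longrightarrow>
      norm (deriv (Top N t lam) (diag y)) \<le> C * sqrt \<kappa> / ((t * \<kappa>) ^ (N + 1) * \<kappa> * (a + y) ^ (2 * N + 2))"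
  shows "norm ((P (diag (1/4)) - (\<Sum>j<Suc N. Sj j t lam (diag (1/4))))
      - (P (diag 0) - (\<Sum>j<Suc N. Sj j t lam (diag 0))))
    \<le> 2 * C * sqrt \<kappa> / ((t * \<kappa>) ^ (N + 1) * a ^ (2 * N + 1))"
proof -
  define Q where "Q z = P z - (\<Sum>j<Suc N. Sj j t lam z)" for z
  define Q' where "Q' z = - (deriv (Top N t lam) z * exp (\<i> * of_real t * Fz z lam))" for z
  define K where "K = 2 * C * sqrt \<kappa> / (t * \<kappa>) ^ (N + 1)"
  have K: "K \<ge> 0" using C \<kappa> t by (simp add: K_def)
  define \<phi> where "\<phi> y = - (K / (a + y) ^ (2 * N + 1))" for y
  define \<phi>' where "\<phi>' y = K * real (2 * N + 1) / (a + y) ^ (2 * N + 2)" for y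
  have dQ: "((\<lambda>y. Q (diag y)) has_vector_derivative of_real \<kappa> * (1 + \<i>) * Q' (diag y)) (at y)"
    if "0 \<le> y" "y \<le> 1/4" for y
    unfolding Q_def Q'_def
    by (intro has_vector_derivative_diag primitive_minus_Sj_has_field_derivative diag_ball(4) that lam t P diag_slit)
  have d\<phi>: "(\<phi> has_vector_derivative \<phi>' y) (at y)" if "0 \<le> y" for y
  proof -
    have "a + y \<noteq> 0" using a that by simp
    then have "(\<phi> has_real_derivative \<phi>' y) (at y)"
      unfolding \<phi>_def \<phi>'_def using minus_inverse_power_has_derivative[of a y K "2 * N"] by simp
    then show ?thesis by (simp add: has_real_derivative_iff_has_vector_derivative)
  qed
  have "norm (Q (diag (1/4)) - Q (diag 0)) \<le> \<phi> (1/4) - \<phi> 0"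
  proof (rule differentiable_bound_general)
    show "continuous_on {0..1/4} (\<lambda>y. Q (diag y))"
      by (intro continuous_at_imp_continuous_on ballI has_vector_derivative_continuous[OF dQ]) auto
    show "continuous_on {0..1/4} \<phi>"
      by (intro continuous_at_imp_continuous_on ballI has_vector_derivative_continuous[OF d\<phi>]) auto
    fix y :: real assume "0 < y" "y < 1/4"
    then have y: "0 \<le> y" "y \<le> 1/4" by auto
    show "((\<lambda>y. Q (diag y)) has_vector_derivative of_real \<kappa> * (1 + \<i>) * Q' (diag y)) (at y)"
      by (rule dQ[OF y])
    show "(\<phi> has_vector_derivative \<phi>' y) (at y)" by (rule d\<phi>[OF y(1)])
    have "norm (of_real \<kappa> * (1 + \<i>) * Q' (diag y)) = \<kappa> * norm (1 + \<i>) * norm (Q' (diag y))"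
      using \<kappa> by (simp add: norm_mult)
    also have "\<dots> \<le> \<kappa> * 2 * (C * sqrt \<kappa> / ((t * \<kappa>) ^ (N + 1) * \<kappa> * (a + y) ^ (2 * N + 2)) * 1)"
    proof (intro mult_mono)
      show "norm (1 + \<i>) \<le> 2" using norm_triangle_ineq[of 1 \<i>] by simp
      show "norm (Q' (diag y)) \<le> C * sqrt \<kappa> / ((t * \<kappa>) ^ (N + 1) * \<kappa> * (a + y) ^ (2 * N + 2)) * 1"
        unfolding Q'_def norm_minus_cancel norm_mult
        using order.trans[OF norm_ge_zero bnd[OF y]]
        by (intro mult_mono bnd y norm_exp_Fz_diag) auto
    qed (use \<kappa> in auto)
    also have "\<dots> = K / (a + y) ^ (2 * N + 2)"
      unfolding K_def using \<kappa> by (simp add: divide_simps)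
    \<comment> \<open>\<open>\<phi>'\<close> carries the surplus factor 2N + 1, at least 1, so that
      its primitive \<open>\<phi>\<close> has the plain constant \<open>K\<close>.\<close>
    also have "\<dots> \<le> \<phi>' y"
      unfolding \<phi>'_def using K a y mult_left_mono[of 1 "real (2 * N + 1)" K]
      by (intro divide_right_mono) auto
    finally show "norm (of_real \<kappa> * (1 + \<i>) * Q' (diag y)) \<le> \<phi>' y" .
  qed simp
  also have "\<dots> \<le> K / a ^ (2 * N + 1)"
    unfolding \<phi>_def using K a by simp
  finally show ?thesis unfolding Q_def K_def by simp
qed

text \<open>Height 1/4 gives 1 - z = \<kappa> (3/4 - a) - x - \<i> \<kappa> / 4, which lies in the
  sector of \<open>Im_Ln_le_of_lower\<close>. The argument of z is positive and
  \<open>ln lam\<close> is real.\<close>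

lemma Im_dFz_horizontal:
  assumes x: "0 \<le> x"
  shows "diag (1/4) + of_real x \<in> slit_plane" "1/4 \<le> Im (dFz (diag (1/4) + of_real x) lam)"
proof -
  define z where "z = diag (1/4) + of_real x"
  have Im: "Im z = \<kappa> / 4" and Re: "Re z = 1 - \<kappa> + \<kappa> * (a + 1/4) + x"
    by (simp_all add: z_def diag_eq)
  show s: "diag (1/4) + of_real x \<in> slit_plane"
    using Im \<kappa> by (simp add: slit_plane_def flip: z_def)
  have "0 < Im (Ln z)"
    using Im \<kappa> by (intro conjunct1[OF Im_Ln_pos_lt_imp]) auto
  moreover have "Im (Ln (1 - z)) \<le> - (1/4)"
  proof (rule Im_Ln_le_of_lower)
    have "0 < \<kappa> * a" using \<kappa> a by simp
    then show "Re (1 - z) \<le> - (3 * Im (1 - z))"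
      using Im Re x by (simp add: algebra_simps)
  qed (use Im \<kappa> in simp)
  ultimately show "1/4 \<le> Im (dFz (diag (1/4) + of_real x) lam)"
    using dFz_eq[OF s lam] by (simp flip: z_def)
qed

text \<open>\<open>\<kappa> / 256\<close> is the value \<kappa> (1/4)^2 / 16 reached at the end of
  the diagonal; from there Im F has slope at least 1/4.\<close>

lemma Im_Fz_horizontal:
  assumes x: "0 \<le> x"
  shows "\<kappa> / 256 + x / 4 \<le> Im (Fz (diag (1/4) + of_real x) lam)"
proof -
  define g where "g x = Im (Fz (diag (1/4) + of_real x * 1) lam) - x / 4" for x
  have "g 0 \<le> g x"
  proof (rule DERIV_nonneg_imp_nondecreasing[OF x])
    fix u assume u: "0 \<le> u" "u \<le> x"
    have s: "diag (1/4) + of_real u * 1 \<in> slit_plane"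
      using Im_dFz_horizontal(1)[OF u(1)] by simp
    have "((\<lambda>x. x / 4) has_real_derivative 1/4) (at u)"
      by (auto intro!: derivative_eq_intros)
    with has_vector_derivative_along_line[OF Fz_has_field_derivative[OF s lam]]
    have "(g has_real_derivative Im (1 * dFz (diag (1/4) + of_real u * 1) lam) - 1/4) (at u)"
      unfolding g_def by (intro DERIV_diff Im_has_real_derivative)
    with Im_dFz_horizontal(2)[OF u(1)]
    show "\<exists>D. (g has_real_derivative D) (at u) \<and> 0 \<le> D" by fastforce
  qed
  moreover have "\<kappa> / 256 \<le> g 0"
    using Im_Fz_diag[of "1/4"] by (simp add: g_def power2_eq_square)
  ultimately show ?thesis by (simp add: g_def)
qed

text \<open>The decay exp(-t x / 4) has total mass 4/t, which meets the amplitude bound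
  \<open>2 * sqrt \<kappa> / \<kappa>\<close>. The estimate does not depend on X, so it survives the
  passage to infinity.\<close>

lemma primitive_horizontal_bound:
  assumes P: "\<And>z. z \<in> slit_plane \<Longrightarrow> (P has_field_derivative JBf t lam z) (at z)"
    and X: "0 \<le> X"
  shows "norm (P (diag (1/4) + of_real X) - P (diag (1/4)))
    \<le> 8 * sqrt \<kappa> / (t * \<kappa>) * exp (- (t * \<kappa> / 256))"
proof (cases "X = 0")
  case True
  then show ?thesis using \<kappa> t by simp
next
  case False
  define K where "K = 8 * sqrt \<kappa> / (t * \<kappa>) * exp (- (t * \<kappa> / 256))"
  have K: "K \<ge> 0" using \<kappa> t by (simp add: K_def)
  define \<phi> where "\<phi> x = - (K * exp (- (t / 4 * x)))" for x
  define \<phi>' where "\<phi>' x = K * (t / 4) * exp (- (t / 4 * x))" for x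
  have dP: "((\<lambda>x. P (diag (1/4) + of_real x * 1)) has_vector_derivative
      1 * JBf t lam (diag (1/4) + of_real x * 1)) (at x)" if "0 \<le> x" for x
    using Im_dFz_horizontal(1)[OF that]
    by (intro has_vector_derivative_along_line P) simp
  have d\<phi>: "(\<phi> has_vector_derivative \<phi>' x) (at x)" for x
    unfolding \<phi>_def \<phi>'_def has_real_derivative_iff_has_vector_derivative[symmetric]
    by (auto intro!: derivative_eq_intros)
  have "norm (P (diag (1/4) + of_real X * 1) - P (diag (1/4) + of_real 0 * 1)) \<le> \<phi> X - \<phi> 0"
  proof (rule differentiable_bound_general)
    show "continuous_on {0..X} (\<lambda>x. P (diag (1/4) + of_real x * 1))"
      by (intro continuous_at_imp_continuous_on ballI has_vector_derivative_continuous[OF dP]) auto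
    show "continuous_on {0..X} \<phi>"
      by (intro continuous_at_imp_continuous_on ballI has_vector_derivative_continuous[OF d\<phi>])
    fix x assume x: "0 < x" "x < X"
    show "((\<lambda>x. P (diag (1/4) + of_real x * 1)) has_vector_derivative
      1 * JBf t lam (diag (1/4) + of_real x * 1)) (at x)"
      using x by (intro dP) auto
    show "(\<phi> has_vector_derivative \<phi>' x) (at x)" by (rule d\<phi>)
    define z where "z = diag (1/4) + of_real x"
    have "\<kappa> / 4 = \<bar>Im (1 - z)\<bar>" using \<kappa> by (simp add: z_def diag_def)
    also have "\<dots> \<le> norm (1 - z)" by (rule abs_Im_le_cmod)
    finally have n: "\<kappa> / 4 \<le> norm (1 - z)" .
    have "t * (\<kappa> / 256 + x / 4) \<le> t * Im (Fz z lam)"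
      using x t unfolding z_def by (intro mult_left_mono Im_Fz_horizontal) auto
    then have "norm (JBf t lam z) \<le> 2 * sqrt \<kappa> / \<kappa> * exp (- (t * (\<kappa> / 256 + x / 4)))"
      unfolding JBf_def norm_mult norm_exp_Fz
      using \<kappa> by (intro mult_mono norm_powr_minus_half_le n) auto
    also have "\<dots> = \<phi>' x"
    proof -
      have *: "- (t * (\<kappa> / 256 + x / 4)) = - (t * \<kappa> / 256) + - (t / 4 * x)"
        by (simp add: algebra_simps)
      show ?thesis unfolding * \<phi>'_def K_def exp_add using t \<kappa> by simp
    qed
    finally show "norm (1 * JBf t lam (diag (1/4) + of_real x * 1)) \<le> \<phi>' x"
      by (simp add: z_def)
  qed (use X False in simp)
  also have "\<dots> \<le> K" using K by (simp add: \<phi>_def)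
  finally show ?thesis by (simp add: K_def)
qed

end

section \<open>The real piece\<close>

lemma norm_exp_ii_diff_le:
  "norm (exp (\<i> * of_real x) - exp (\<i> * of_real y)) \<le> \<bar>x - y\<bar>"
proof -
  have *: "norm (exp (\<i> * of_real x) - exp (\<i> * of_real y)) \<le> x - y" if "y < x" for x y :: real
  proof (rule differentiable_bound_general[OF that])
    show "((\<lambda>u. exp (\<i> * of_real u)) has_vector_derivative \<i> * exp (\<i> * of_real u)) (at u)" for u
      using has_vector_derivative_along_line[where c = 0 and x = u and d = \<i>, OF DERIV_exp] by (simp add: mult.commute)
    show "continuous_on {y..x} (\<lambda>u. exp (\<i> * of_real u))"
      by (intro continuous_intros)
    show "((\<lambda>u. u) has_vector_derivative 1) (at u)" for u :: real
      by (auto intro!: derivative_eq_intros)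
    show "norm (\<i> * exp (\<i> * of_real u)) \<le> 1" for u
      by (simp add: norm_mult)
  qed (intro continuous_intros)
  show ?thesis
    using *[of y x] *[of x y] by (cases x y rule: linorder_cases) (auto simp: norm_minus_commute)
qed

text \<open>Up to the factor t \<kappa> this is the derivative of the error of the quadratic phase.
  The constant 3 makes the integrated bound v^3.\<close>

lemma ln_remainder_bound:
  fixes v c :: real
  assumes v: "0 \<le> v" "v \<le> 1/2" and c: "0 \<le> c" "c \<le> 1"
  shows "\<bar>(ln (1 + c * v) - c * v) - (ln (1 - v) + v)\<bar> \<le> 3 * v\<^sup>2"
proof -
  have cv: "0 \<le> c * v" "c * v \<le> v"
    using v c mult_right_mono[of c 1 v] by auto
  have "(c * v)\<^sup>2 \<le> v\<^sup>2" using cv by (intro power_mono)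
  moreover have "c * v - (c * v)\<^sup>2 \<le> ln (1 + c * v)" "ln (1 + c * v) \<le> c * v"
    using cv v by (intro ln_one_plus_pos_lower_bound ln_add_one_self_le_self; simp)+
  moreover have "- v - 2 * v\<^sup>2 \<le> ln (1 - v)"
    using v by (intro ln_one_minus_pos_lower_bound) auto
  moreover have "ln (1 - v) \<le> - v"
    using v ln_le_minus_one[of "1 - v"] by simp
  moreover have "0 \<le> v\<^sup>2" by simp
  ultimately show ?thesis unfolding abs_le_iff by linarith
qed

lemma powr_minus_half_eq:
  fixes x :: real
  assumes "0 \<le> x"
  shows "x powr (-1/2) = 1 / sqrt x"
proof -
  have "x powr (-1/2) = inverse (x powr (1/2))"
    using powr_minus[of x "1/2"] by simp
  then show ?thesis using assms by (simp only: powr_half_sqrt inverse_eq_divide)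
qed

text \<open>The upper half rests on (1 - v) (1 + v)^2 = 1 + v - v^2 - v^3, which is at least 1 for v
  in [0, 1/2].\<close>

lemma inverse_sqrt_bound:
  fixes v :: real
  assumes v: "0 \<le> v" "v \<le> 1/2"
  shows "\<bar>(1 - v) powr (-1/2) - 1\<bar> \<le> v"
proof -
  have eq: "(1 - v) powr (-1/2) = 1 / sqrt (1 - v)"
    using v by (intro powr_minus_half_eq) auto
  have "1 / (1 + v) \<le> sqrt (1 - v)"
  proof (rule real_le_rsqrt)
    have "v * v \<le> 1/2 * v" "v * (v * v) \<le> 1/4 * v"
      using v mult_mono[of v "1/2" v "1/2"] mult_left_mono[of "v * v" "1/4" v] mult_right_mono[of v "1/2" v] by auto
    then have "1 \<le> (1 - v) * (1 + v)\<^sup>2"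
      using v by (simp add: power2_eq_square algebra_simps)
    then show "(1 / (1 + v))\<^sup>2 \<le> 1 - v"
      using v by (simp add: power_divide divide_le_eq mult.commute)
  qed
  then have "1 / sqrt (1 - v) \<le> 1 + v"
    using v by (simp add: divide_simps mult.commute)
  moreover have "1 \<le> 1 / sqrt (1 - v)" using v by (simp add: real_le_lsqrt)
  ultimately show ?thesis unfolding eq by (simp add: abs_le_iff)
qed

text \<open>The restriction of \<open>Fz\<close> to (0, 1) as a real function, so that the phase can
  be differentiated over the reals.\<close>

definition Fr :: "real \<Rightarrow> real \<Rightarrow> real" where
  "Fr x lam = (1 - x) * ln (1 - x) + x * ln x + x * ln lam"

lemma Fr_has_real_derivative:
  assumes "0 < x" "x < 1" "lam > 0"
  shows "((\<lambda>x. Fr x lam) has_real_derivative ln x - ln (1 - x) + ln lam) (at x)"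
proof -
  have "1 + x * inverse (1 - x) = inverse (1 - x)" using assms by (simp add: field_simps)
  then show ?thesis
    unfolding Fr_def using assms by (auto intro!: derivative_eq_intros simp: algebra_simps divide_inverse)
qed

text \<open>An entire primitive lets the Fresnel integral enter as a difference of values, just as
  \<open>P\<close> does for the contour integrals.\<close>

lemma Fresnel_primitive:
  obtains \<Phi> where "\<And>z. (\<Phi> has_field_derivative exp (\<i> * z\<^sup>2)) (at z)"
    "\<And>x y. x \<le> y \<Longrightarrow> integral {x..y} (\<lambda>\<xi>. exp (\<i> * of_real (\<xi>\<^sup>2))) = \<Phi> (of_real y) - \<Phi> (of_real x)"
proof -
  have hol: "(\<lambda>z. exp (\<i> * z\<^sup>2)) holomorphic_on UNIV"
    by (intro holomorphic_intros)
  obtain \<Phi> where \<Phi>: "\<And>z. (\<Phi> has_field_derivative exp (\<i> * z\<^sup>2)) (at z)"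
    using holomorphic_convex_primitive'[OF convex_UNIV open_UNIV hol] by auto
  have "integral {x..y} (\<lambda>\<xi>. exp (\<i> * of_real (\<xi>\<^sup>2))) = \<Phi> (of_real y) - \<Phi> (of_real x)" if "x \<le> y" for x y
  proof (rule integral_unique[OF fundamental_theorem_of_calculus[OF that]])
    fix \<xi> :: real
    have "((\<lambda>\<xi>. \<Phi> (0 + of_real \<xi> * 1)) has_vector_derivative 1 * exp (\<i> * (0 + of_real \<xi> * 1)\<^sup>2)) (at \<xi>)"
      by (rule has_vector_derivative_along_line[OF \<Phi>])
    then show "((\<lambda>\<xi>. \<Phi> (of_real \<xi>)) has_vector_derivative exp (\<i> * of_real (\<xi>\<^sup>2))) (at \<xi> within {x..y})"
      by (simp add: has_vector_derivative_at_within)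
  qed
  with \<Phi> that show ?thesis by blast
qed

context steepest
begin

text \<open>\<open>S\<close> is sqrt(\<lambda>_c t / 2), \<open>L\<close> is ln(1 + \<Lambda>), and
  \<open>om\<close> is \<omega> because 1/(1 + \<lambda>_c) = 1 - \<kappa>.\<close>

definition S where "S = sqrt (t * \<kappa> / (2 * (1 - \<kappa>)))"
definition L where "L = ln (lam * (1 - \<kappa>) / \<kappa>)"
definition om where "om = S * L * (1 - \<kappa>)"

text \<open>Completing the square. With c = \<kappa>/(1 - \<kappa>) the derivative of the phase in v
  is t \<kappa> (L + ln(1 + c v) - ln(1 - v)), whose affine part t \<kappa> (L + (1 + c) v) is
  exactly the derivative of (om + v S)^2. The rest is quadratic in v, hence the cubic bound;
  \<kappa> \<le> 1/2 gives c \<le> 1.\<close>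

lemma phase_bound:
  assumes v: "0 \<le> v" "v \<le> 1/2" and half: "\<kappa> \<le> 1/2"
  shows "\<bar>t * Fr (1 - \<kappa> + \<kappa> * v) lam - t * Fr (1 - \<kappa>) lam - ((om + v * S)\<^sup>2 - om\<^sup>2)\<bar> \<le> t * \<kappa> * v ^ 3"
proof (cases "v = 0")
  case True
  then show ?thesis by simp
next
  case False
  define R where "R v = t * Fr (1 - \<kappa> + \<kappa> * v) lam - t * Fr (1 - \<kappa>) lam - ((om + v * S)\<^sup>2 - om\<^sup>2)" for v
  define c where "c = \<kappa> / (1 - \<kappa>)"
  have c: "0 \<le> c" "c \<le> 1" using \<kappa> half by (auto simp: c_def divide_simps)
  have S2: "S * S = t * \<kappa> / (2 * (1 - \<kappa>))"
    using \<kappa> t by (simp add: S_def)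
  define R' where "R' u = t * \<kappa> * ((ln (1 + c * u) - c * u) - (ln (1 - u) + u))" for u
  have dR: "(R has_real_derivative R' u) (at u)" if u: "0 \<le> u" "u \<le> 1/2" for u
  proof -
    define x where "x = 1 - \<kappa> + \<kappa> * u"
    have x1: "1 - x = \<kappa> * (1 - u)" and x2: "x = (1 - \<kappa>) * (1 + c * u)"
      using \<kappa> by (simp_all add: x_def c_def field_simps)
    have cu: "0 < 1 + c * u" using c u by (simp add: add_pos_nonneg)
    have x: "0 < x" "x < 1"
    proof -
      show "0 < x" unfolding x2 using \<kappa> cu by simp
      have "0 < 1 - x" unfolding x1 using \<kappa> u by simp
      then show "x < 1" by simp
    qed
    have "((\<lambda>u. Fr (1 - \<kappa> + \<kappa> * u) lam) has_real_derivative (ln x - ln (1 - x) + ln lam) * \<kappa>) (at u)"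
    proof (rule DERIV_chain2[where f = "\<lambda>x. Fr x lam" and g = "\<lambda>u. 1 - \<kappa> + \<kappa> * u"])
      show "((\<lambda>x. Fr x lam) has_real_derivative ln x - ln (1 - x) + ln lam) (at (1 - \<kappa> + \<kappa> * u))"
        using Fr_has_real_derivative[OF x lam] by (simp add: x_def)
    qed (auto intro!: derivative_eq_intros)
    then have D: "(R has_real_derivative t * ((ln x - ln (1 - x) + ln lam) * \<kappa>) - 2 * (om + u * S) * S) (at u)"
      unfolding R_def by (auto intro!: derivative_eq_intros)
    have "ln x - ln (1 - x) + ln lam = L + ln (1 + c * u) - ln (1 - u)"
    proof -
      have "ln x = ln (1 - \<kappa>) + ln (1 + c * u)" unfolding x2 using \<kappa> cu by (simp add: ln_mult)
      moreover have "ln (1 - x) = ln \<kappa> + ln (1 - u)" unfolding x1 using \<kappa> u by (simp add: ln_mult)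
      moreover have "L = ln lam + ln (1 - \<kappa>) - ln \<kappa>"
        unfolding L_def using \<kappa> lam by (simp add: ln_mult ln_div)
      ultimately show ?thesis by simp
    qed
    moreover have "2 * (om + u * S) * S = t * \<kappa> * (L + u * (1 + c))"
    proof -
      have "2 * (om + u * S) * S = 2 * (S * S) * (L * (1 - \<kappa>) + u)"
        by (simp add: om_def algebra_simps)
      also have "\<dots> = t * \<kappa> * (L + u * (1 + c))"
        unfolding S2 c_def using \<kappa> by (simp add: field_simps)
      finally show ?thesis .
    qed
    ultimately have "t * ((ln x - ln (1 - x) + ln lam) * \<kappa>) - 2 * (om + u * S) * S = R' u"
      by (simp only: R'_def) (simp add: algebra_simps)
    with D show ?thesis by simp
  qed
  have "norm (R v - R 0) \<le> t * \<kappa> * v ^ 3 - t * \<kappa> * 0 ^ 3"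
  proof (rule differentiable_bound_general[where f' = R' and \<phi> = "\<lambda>v. t * \<kappa> * v ^ 3" and \<phi>' = "\<lambda>u. t * \<kappa> * (3 * u\<^sup>2)"])
    show "continuous_on {0..v} R"
      using v by (intro continuous_at_imp_continuous_on ballI DERIV_isCont[OF dR]) auto
    show "continuous_on {0..v} (\<lambda>v. t * \<kappa> * v ^ 3)" by (intro continuous_intros)
    fix u assume u: "0 < u" "u < v"
    then have u': "0 \<le> u" "u \<le> 1/2" using v by auto
    show "(R has_vector_derivative R' u) (at u)"
      using dR[OF u'] by (simp add: has_real_derivative_iff_has_vector_derivative)
    show "((\<lambda>v. t * \<kappa> * v ^ 3) has_vector_derivative t * \<kappa> * (3 * u\<^sup>2)) (at u)"
      unfolding has_real_derivative_iff_has_vector_derivative[symmetric]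
      by (auto intro!: derivative_eq_intros simp: power2_eq_square)
    show "norm (R' u) \<le> t * \<kappa> * (3 * u\<^sup>2)"
      unfolding R'_def real_norm_def abs_mult
      using \<kappa> t by (intro mult_mono ln_remainder_bound u' c) auto
  qed (use v False in auto)
  moreover have "R 0 = 0" by (simp add: R_def)
  ultimately show ?thesis by (simp add: R_def)
qed

lemma JBf_real:
  assumes v: "0 \<le> v" "v \<le> 1/2"
  shows "JBf t lam (of_real (1 - \<kappa>) + of_real v * of_real \<kappa>)
    = of_real (sqrt \<kappa> / \<kappa> * (1 - v) powr (-1/2)) * exp (\<i> * of_real (t * Fr (1 - \<kappa> + \<kappa> * v) lam))"
proof -
  define x where "x = 1 - \<kappa> + \<kappa> * v"
  have x1: "1 - x = \<kappa> * (1 - v)" by (simp add: x_def algebra_simps)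
  have z: "of_real (1 - \<kappa>) + of_real v * of_real \<kappa> = complex_of_real x"
    by (simp add: x_def mult.commute)
  have "0 \<le> \<kappa> * v" using \<kappa> v by simp
  then have "0 < x" using \<kappa> by (simp add: x_def)
  moreover have "0 < 1 - x" unfolding x1 using \<kappa> v by simp
  ultimately have F: "Fz (of_real x) lam = of_real (Fr x lam)"
    by (simp add: Fz_of_real Fr_def)
  have "(1 - of_real x) powr (-1/2::complex) = of_real ((1 - x) powr (-1/2))"
    using \<open>0 < 1 - x\<close> powr_of_real[of "1 - x" "-1/2"] by simp
  also have "(1 - x) powr (-1/2) = \<kappa> powr (-1/2) * (1 - v) powr (-1/2)"
    unfolding x1 using \<kappa> v by (simp add: powr_mult)
  also have "\<kappa> powr (-1/2) = sqrt \<kappa> / \<kappa>"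
    unfolding powr_minus_half_eq[OF less_imp_le[OF \<kappa>(1)]] using \<kappa> by (simp add: divide_simps)
  finally show ?thesis unfolding z JBf_def F x_def[symmetric] by (simp add: mult.assoc)
qed

text \<open>The substitution \<xi> = om + v S turns the model integrand into the Fresnel one with
  amplitude \<open>sqrt \<kappa> / S\<close>. Replacing the amplitude
  \<open>(1 - v) powr (-1/2)\<close> by 1 costs v, replacing the phase costs t \<kappa> v^3, both
  times \<open>sqrt \<kappa>\<close>; these are integrated up to a.\<close>

lemma stationary_piece_bound:
  assumes P: "\<And>z. z \<in> slit_plane \<Longrightarrow> (P has_field_derivative JBf t lam z) (at z)"
    and half: "\<kappa> \<le> 1/2"
  shows "norm (P (diag 0) - P (of_real (1 - \<kappa>))
      - exp (\<i> * of_real t * Fz (of_real (1 - \<kappa>)) lam - \<i> * of_real (om\<^sup>2)) * of_real (sqrt \<kappa> / S)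
        * integral {om..om + a * S} (\<lambda>\<xi>. exp (\<i> * of_real (\<xi>\<^sup>2))))
    \<le> sqrt \<kappa> * (a\<^sup>2 + t * \<kappa> * a ^ 4)"
proof -
  obtain \<Phi> where \<Phi>: "\<And>z. (\<Phi> has_field_derivative exp (\<i> * z\<^sup>2)) (at z)"
    and int: "\<And>x y. x \<le> y \<Longrightarrow> integral {x..y} (\<lambda>\<xi>. exp (\<i> * of_real (\<xi>\<^sup>2))) = \<Phi> (of_real y) - \<Phi> (of_real x)"
    by (rule Fresnel_primitive) blast
  have S: "S > 0" using \<kappa> t by (simp add: S_def)
  define F0 where "F0 = Fr (1 - \<kappa>) lam"
  have F0: "Fz (of_real (1 - \<kappa>)) lam = of_real F0"
    unfolding F0_def Fr_def using \<kappa> by (intro Fz_of_real) auto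
  define A where "A = exp (\<i> * of_real (t * F0 - om\<^sup>2))"
  define z where "z v = of_real (1 - \<kappa>) + of_real v * complex_of_real \<kappa>" for v
  \<comment> \<open>The difference of the true and the model primitive, so one derivative bound
    controls both errors.\<close>
  define H where "H v = P (z v) - A * of_real (sqrt \<kappa> / S) * \<Phi> (of_real om + of_real v * of_real S)" for v
  define H' where "H' v = of_real \<kappa> * JBf t lam (z v)
    - A * of_real (sqrt \<kappa> / S) * (of_real S * exp (\<i> * (of_real om + of_real v * of_real S)\<^sup>2))" for v
  define \<phi> where "\<phi> v = sqrt \<kappa> * (v\<^sup>2 / 2 + t * \<kappa> * (v ^ 4 / 4))" for v :: real
  define \<phi>' where "\<phi>' v = sqrt \<kappa> * (v + t * \<kappa> * v ^ 3)" for v :: real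
  have zs: "z v \<in> slit_plane" if "0 \<le> v" "v \<le> a" for v
  proof -
    have "\<kappa> * v < \<kappa>" using that a \<kappa> by simp
    moreover have "0 \<le> \<kappa> * v" using that \<kappa> by simp
    ultimately show ?thesis
      using \<kappa> by (simp add: z_def slit_plane_def mult.commute)
  qed
  have dH: "(H has_vector_derivative H' v) (at v)" if "0 \<le> v" "v \<le> a" for v
    unfolding H_def H'_def z_def using zs[OF that, unfolded z_def]
    by (intro has_vector_derivative_diff has_vector_derivative_mult_right
        has_vector_derivative_along_line P \<Phi>)
  have d\<phi>: "(\<phi> has_vector_derivative \<phi>' v) (at v)" for v
    unfolding \<phi>_def \<phi>'_def has_real_derivative_iff_has_vector_derivative[symmetric]
    by (auto intro!: derivative_eq_intros simp: algebra_simps)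
  have "norm (H a - H 0) \<le> \<phi> a - \<phi> 0"
  proof (rule differentiable_bound_general)
    show "continuous_on {0..a} H"
      by (intro continuous_at_imp_continuous_on ballI has_vector_derivative_continuous[OF dH]) auto
    show "continuous_on {0..a} \<phi>"
      by (intro continuous_at_imp_continuous_on ballI has_vector_derivative_continuous[OF d\<phi>])
    fix v assume v: "0 < v" "v < a"
    show "(H has_vector_derivative H' v) (at v)" using v by (intro dH) auto
    show "(\<phi> has_vector_derivative \<phi>' v) (at v)" by (rule d\<phi>)
    define b where "b = (1 - v) powr (-1/2)"
    define \<alpha> where "\<alpha> = t * Fr (1 - \<kappa> + \<kappa> * v) lam"
    define \<beta> where "\<beta> = t * F0 - om\<^sup>2 + (om + v * S)\<^sup>2"
    have v': "0 \<le> v" "v \<le> 1/2" using v a by auto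
    have "H' v = of_real (sqrt \<kappa>) * (of_real b * exp (\<i> * of_real \<alpha>) - exp (\<i> * of_real \<beta>))"
    proof -
      have J: "JBf t lam (z v) = of_real (sqrt \<kappa> / \<kappa> * b) * exp (\<i> * of_real \<alpha>)"
        unfolding z_def b_def \<alpha>_def by (rule JBf_real[OF v'])
      have "A * exp (\<i> * (of_real om + of_real v * of_real S)\<^sup>2) = exp (\<i> * of_real \<beta>)"
        unfolding A_def \<beta>_def exp_add[symmetric] by (simp add: algebra_simps)
      then have "H' v = of_real \<kappa> * JBf t lam (z v) - of_real (sqrt \<kappa>) * exp (\<i> * of_real \<beta>)"
        unfolding H'_def using S by simp
      then show ?thesis
        using \<kappa> by (simp add: J algebra_simps)
    qed
    also have "norm \<dots> = sqrt \<kappa> * norm (of_real (b - 1) * exp (\<i> * of_real \<alpha>)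
        + (exp (\<i> * of_real \<alpha>) - exp (\<i> * of_real \<beta>)))"
    proof -
      have "of_real b * exp (\<i> * of_real \<alpha>) - exp (\<i> * of_real \<beta>)
        = of_real (b - 1) * exp (\<i> * of_real \<alpha>) + (exp (\<i> * of_real \<alpha>) - exp (\<i> * of_real \<beta>))"
        by (simp add: algebra_simps)
      then show ?thesis using \<kappa> by (simp only: norm_mult norm_of_real) simp
    qed
    also have "\<dots> \<le> sqrt \<kappa> * (v + t * \<kappa> * v ^ 3)"
    proof (intro mult_left_mono norm_triangle_mono)
      show "norm (of_real (b - 1) * exp (\<i> * of_real \<alpha>)) \<le> v"
        using inverse_sqrt_bound[OF v'] unfolding norm_mult norm_of_real b_def by simp
      have "\<bar>\<alpha> - \<beta>\<bar> \<le> t * \<kappa> * v ^ 3"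
        using phase_bound[OF v' half] by (simp add: \<alpha>_def \<beta>_def F0_def algebra_simps)
      with norm_exp_ii_diff_le[of \<alpha> \<beta>]
      show "norm (exp (\<i> * of_real \<alpha>) - exp (\<i> * of_real \<beta>)) \<le> t * \<kappa> * v ^ 3" by linarith
    qed (use \<kappa> in simp)
    finally show "norm (H' v) \<le> \<phi>' v" by (simp add: \<phi>'_def)
  qed (use a in simp)
  also have "\<dots> \<le> sqrt \<kappa> * (a\<^sup>2 + t * \<kappa> * a ^ 4)"
  proof -
    have "0 \<le> t * \<kappa> * a ^ 4" "0 \<le> a\<^sup>2" using \<kappa> t by simp_all
    then have "a\<^sup>2 / 2 + t * \<kappa> * (a ^ 4 / 4) \<le> a\<^sup>2 + t * \<kappa> * a ^ 4"
      unfolding times_divide_eq_right by linarith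
    then show ?thesis unfolding \<phi>_def using \<kappa> by (simp add: mult_left_mono)
  qed
  also have "H a - H 0 = P (diag 0) - P (of_real (1 - \<kappa>))
      - exp (\<i> * of_real t * Fz (of_real (1 - \<kappa>)) lam - \<i> * of_real (om\<^sup>2)) * of_real (sqrt \<kappa> / S)
        * integral {om..om + a * S} (\<lambda>\<xi>. exp (\<i> * of_real (\<xi>\<^sup>2)))"
  proof -
    have "om \<le> om + a * S" using a S by simp
    note i = int[OF this]
    have e: "exp (\<i> * of_real t * Fz (of_real (1 - \<kappa>)) lam - \<i> * of_real (om\<^sup>2)) = A"
      by (simp only: F0 A_def) (simp add: algebra_simps)
    have z: "diag 0 = z a" "of_real (1 - \<kappa>) = z 0"
      by (simp_all add: z_def diag_def algebra_simps)
    show ?thesis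
      unfolding i e unfolding z unfolding H_def by (simp add: algebra_simps)
  qed
  finally show ?thesis .
qed

end

section \<open>The ray integral\<close>

text \<open>In the upper half plane Ln(1 - z) = Ln(z - 1) - \<i> pi, which isolates the growing
  terms \<i> pi z and z ln lam. What is left is z (Ln z - Ln(z - 1)), of modulus at most 3, and Im
  Ln(z - 1) - pi, which exceeds -pi; 7 covers 3 + pi.\<close>

lemma Im_Fz_ge:
  assumes im: "0 < Im z" and far: "4 \<le> norm z"
  shows "pi * Re z + ln lam * Im z - 7 \<le> Im (Fz z lam)"
proof -
  have nz: "z \<noteq> 0" "z - 1 \<noteq> 0" using im by auto
  have n: "norm z \<le> norm (z - 1) + 1"
    using norm_triangle_ineq[of "z - 1" 1] by simp
  define D where "D = Ln z - Ln (z - 1)"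
  have i1: "0 < Im (Ln z)" "Im (Ln z) < pi" "0 < Im (Ln (z - 1))" "Im (Ln (z - 1)) < pi"
    using Im_Ln_pos_lt_imp[of z] Im_Ln_pos_lt_imp[of "z - 1"] im by auto
  have "exp D = 1 + 1 / (z - 1)"
    unfolding D_def exp_diff using nz by (simp add: field_simps)
  then have "D = Ln (1 + 1 / (z - 1))"
    using i1 by (intro Ln_unique[symmetric]) (auto simp: D_def)
  also have "norm \<dots> \<le> 2 * norm (1 / (z - 1))"
  proof (rule norm_Ln_le)
    show "norm (1 / (z - 1)) < 1/2" using n far nz by (simp add: norm_divide divide_simps)
  qed
  finally have "norm (z * D) \<le> norm z * (2 * norm (1 / (z - 1)))"
    unfolding norm_mult by (intro mult_left_mono) auto
  also have "\<dots> \<le> 3" using n far nz by (simp add: norm_divide divide_simps)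
  finally have "- 3 \<le> Im (z * D)" using abs_Im_le_cmod[of "z * D"] by linarith
  moreover have "Fz z lam = z * D + Ln (z - 1) - \<i> * pi + \<i> * pi * z + z * of_real (ln lam)"
  proof -
    have L: "Ln (1 - z) = Ln (z - 1) - \<i> * pi"
      using Ln_minus[OF nz(2)] im by simp
    show ?thesis unfolding Fz_def D_def L by (simp add: algebra_simps)
  qed
  then have "Im (Fz z lam) = Im (z * D) + Im (Ln (z - 1)) - pi + pi * Re z + ln lam * Im z"
    by (simp add: mult.commute)
  ultimately show ?thesis using i1(3) pi_less_4 by linarith
qed

text \<open>The third quantity is the linear growth rate of Im F along the ray. For negative
  \<open>ln lam\<close> its positivity means tan phi < pi / |ln lam|, which is what the arctan in
  \<open>phi_adm\<close> encodes.\<close>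

lemma phi_adm_pos:
  assumes "phi_adm lam phi"
  shows "0 < sin phi" "0 < cos phi" "0 < pi * cos phi + ln lam * sin phi"
proof -
  have "0 < phi \<and> phi < pi / 2"
  proof (cases "ln lam \<ge> 0")
    case False
    then show ?thesis
      using assms arctan_ubound[of "pi / \<bar>ln lam\<bar>"] by (auto simp: phi_adm_def)
  qed (use assms in \<open>auto simp: phi_adm_def\<close>)
  then have phi: "0 < phi" "phi < pi / 2" by auto
  show s: "0 < sin phi" using phi pi_gt_zero by (intro sin_gt_zero) auto
  show c: "0 < cos phi" using phi by (intro cos_gt_zero) auto
  show "0 < pi * cos phi + ln lam * sin phi"
  proof (cases "ln lam \<ge> 0")
    case True
    then show ?thesis using s c by (intro add_pos_nonneg mult_nonneg_nonneg mult_pos_pos) auto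
  next
    case False
    then have "phi < arctan (pi / \<bar>ln lam\<bar>)" using assms by (auto simp: phi_adm_def)
    then have "tan phi < pi / \<bar>ln lam\<bar>"
      using phi arctan_less_iff[of "tan phi" "pi / \<bar>ln lam\<bar>"] by (simp add: arctan_tan)
    then show ?thesis using False c by (simp add: tan_def divide_simps mult.commute)
  qed
qed

context steepest
begin

lemma norm_JBf_far_le:
  assumes "0 < Im z" "4 \<le> norm z" "\<mu> \<le> pi * Re z + ln lam * Im z"
  shows "norm (JBf t lam z) \<le> exp (t * 7) * exp (- (t * \<mu>))"
proof -
  have "1 \<le> norm (1 - z)"
    using norm_triangle_ineq[of "z - 1" 1] assms(2) by (simp add: norm_minus_commute)
  then have "norm (1 - z) powr (-1/2) \<le> 1 powr (-1/2)"
    by (intro powr_mono2') auto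
  then have "norm ((1 - z) powr (-1/2)) \<le> 1" by (simp only: norm_powr_minus_half) simp
  moreover have "t * (\<mu> - 7) \<le> t * Im (Fz z lam)"
    using Im_Fz_ge[OF assms(1,2), of lam] assms(3) t by (intro mult_left_mono) auto
  ultimately have "norm (JBf t lam z) \<le> 1 * exp (- (t * (\<mu> - 7)))"
    unfolding JBf_def norm_mult norm_exp_Fz by (intro mult_mono) auto
  also have "\<dots> = exp (t * 7) * exp (- (t * \<mu>))"
    by (simp add: algebra_simps flip: exp_add)
  finally show ?thesis .
qed

definition ray :: "real \<Rightarrow> real \<Rightarrow> complex" where
  "ray phi s = of_real (1 - \<kappa>) + of_real s * cis phi"

lemma ray_Re_Im [simp]: "Re (ray phi s) = 1 - \<kappa> + s * cos phi" "Im (ray phi s) = s * sin phi"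
  by (simp_all add: ray_def)

lemma ray_slit: "0 < sin phi \<Longrightarrow> 0 \<le> s \<Longrightarrow> ray phi s \<in> slit_plane"
  using \<kappa> by (cases "s = 0") (auto simp: slit_plane_def)

text \<open>Compactness handles s \<le> 5; beyond that |z| \<ge> s - (1 - \<kappa>) \<ge> 4 and the
  far bound applies. The result is the majorant for dominated convergence.\<close>

lemma ray_integrand_bound:
  assumes phi: "phi_adm lam phi"
  obtains M \<mu> where "0 < \<mu>" "\<And>s. 0 \<le> s \<Longrightarrow> norm (JBf t lam (ray phi s) * cis phi) \<le> M * exp (- \<mu> * s)"
proof -
  note pos = phi_adm_pos[OF phi]
  define \<mu> where "\<mu> = pi * cos phi + ln lam * sin phi"
  have \<mu>: "0 < \<mu>" using pos by (simp add: \<mu>_def)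
  have "continuous_on {0..5} (\<lambda>s. JBf t lam (ray phi s))"
  proof (rule continuous_on_compose2[OF holomorphic_on_imp_continuous_on[OF JBf_holomorphic[OF lam]]])
    show "continuous_on {0..5} (ray phi)"
      unfolding ray_def by (intro continuous_intros)
  qed (use ray_slit[OF pos(1)] in auto)
  then have "bounded ((\<lambda>s. JBf t lam (ray phi s)) ` {0..5})"
    by (intro compact_imp_bounded compact_continuous_image) auto
  then obtain B where B: "B > 0" "\<And>s. 0 \<le> s \<Longrightarrow> s \<le> 5 \<Longrightarrow> norm (JBf t lam (ray phi s)) \<le> B"
    unfolding bounded_pos by auto
  \<comment> \<open>The factor \<open>exp (t * \<mu> * 5)\<close> offsets the decaying exponential
    on [0, 5].\<close>
  define M where "M = max (B * exp (t * \<mu> * 5)) (exp (t * 7))"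
  have "norm (JBf t lam (ray phi s) * cis phi) \<le> M * exp (- (t * \<mu>) * s)" if s: "0 \<le> s" for s
  proof (cases "s \<le> 5")
    case True
    have "norm (JBf t lam (ray phi s) * cis phi) \<le> B * 1" using B(2)[OF s True] by (simp add: norm_mult)
    also have "\<dots> \<le> B * (exp (t * \<mu> * 5) * exp (- (t * \<mu>) * s))"
      unfolding exp_add[symmetric] using True t \<mu> B(1) by (intro mult_left_mono) (auto simp: mult_left_mono)
    also have "\<dots> \<le> M * exp (- (t * \<mu>) * s)"
      unfolding mult.assoc[symmetric] M_def by (intro mult_right_mono) auto
    finally show ?thesis .
  next
    case False
    have "s = norm (ray phi s - of_real (1 - \<kappa>))" using s by (simp add: ray_def norm_mult)
    also have "\<dots> \<le> norm (ray phi s) + norm (complex_of_real (1 - \<kappa>))" by (rule norm_triangle_ineq4)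
    also have "norm (complex_of_real (1 - \<kappa>)) = 1 - \<kappa>"
      unfolding norm_of_real using \<kappa> by simp
    finally have "4 \<le> norm (ray phi s)" using False \<kappa> by simp
    moreover have "\<mu> * s \<le> pi * Re (ray phi s) + ln lam * Im (ray phi s)"
    proof -
      have "0 \<le> pi * (1 - \<kappa>)" using \<kappa> by simp
      then show ?thesis by (simp add: \<mu>_def algebra_simps)
    qed
    ultimately have "norm (JBf t lam (ray phi s)) \<le> exp (t * 7) * exp (- (t * (\<mu> * s)))"
      using False pos by (intro norm_JBf_far_le) auto
    also have "\<dots> \<le> M * exp (- (t * \<mu>) * s)"
      unfolding M_def by (intro mult_mono) (auto simp: mult.assoc le_max_iff_disj)
    finally show ?thesis by (simp add: norm_mult)
  qed
  with that[of "t * \<mu>" M] \<mu> t show thesis by simp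
qed

text \<open>Dominated convergence identifies the integral over the half line with the limit of its
  truncations, each of which is a difference of values of \<open>P\<close>.\<close>

lemma JB_eq_limit:
  assumes P: "\<And>z. z \<in> slit_plane \<Longrightarrow> (P has_field_derivative JBf t lam z) (at z)"
    and phi: "phi_adm lam phi" and \<kappa>_eq: "\<kappa> = t powr (\<delta> - 1)"
  shows "(\<lambda>n. P (ray phi (real n)) - P (of_real (1 - \<kappa>))) \<longlonglongrightarrow> JB \<delta> t lam phi"
proof -
  note pos = phi_adm_pos[OF phi]
  define f where "f s = JBf t lam (ray phi s) * cis phi" for s
  obtain M \<mu> where \<mu>: "0 < \<mu>" and M: "\<And>s. 0 \<le> s \<Longrightarrow> norm (f s) \<le> M * exp (- \<mu> * s)"
    using ray_integrand_bound[OF phi] unfolding f_def by metis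
  have int: "(f has_integral P (ray phi X) - P (ray phi 0)) {0..X}" if "0 \<le> X" for X
  proof (rule fundamental_theorem_of_calculus[OF that])
    fix s assume "s \<in> {0..X}"
    then have "((\<lambda>s. P (ray phi s)) has_vector_derivative cis phi * JBf t lam (ray phi s)) (at s)"
      using ray_slit[OF pos(1), of s] unfolding ray_def
      by (intro has_vector_derivative_along_line P) auto
    then show "((\<lambda>s. P (ray phi s)) has_vector_derivative f s) (at s within {0..X})"
      by (simp add: f_def mult.commute has_vector_derivative_at_within)
  qed
  define g where "g n s = (if s \<in> {0..real n} then f s else 0)" for n s
  have gi: "(g n has_integral P (ray phi n) - P (ray phi 0)) {0..}" for n
    unfolding g_def by (subst has_integral_restrict) (auto intro: int)
  have "(\<lambda>n. integral {0..} (g n)) \<longlonglongrightarrow> integral {0..} f"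
  proof (rule dominated_convergence(2))
    show "g n integrable_on {0..}" for n using gi by blast
    show "(\<lambda>s. M * exp (- \<mu> * s)) integrable_on {0..}"
      using integrable_on_exp_minus_to_infinity[OF \<mu>] by (rule integrable_on_mult_right)
    have M0: "0 \<le> M" using order.trans[OF norm_ge_zero M[of 0]] by simp
    show "norm (g n s) \<le> M * exp (- \<mu> * s)" if "s \<in> {0..}" for n s
      using that M[of s] M0 by (auto simp: g_def)
    show "(\<lambda>n. g n s) \<longlonglongrightarrow> f s" if "s \<in> {0..}" for s
    proof (rule tendsto_eventually)
      have "eventually (\<lambda>n. s \<le> real n) sequentially"
        using eventually_ge_at_top[of "nat \<lceil>s\<rceil>"] by eventually_elim linarith
      then show "eventually (\<lambda>n. g n s = f s) sequentially"
        by eventually_elim (use that in \<open>auto simp: g_def\<close>)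
    qed
  qed
  also have "integral {0..} f = JB \<delta> t lam phi"
    unfolding JB_def Let_def \<kappa>_eq[symmetric] f_def[abs_def] JBf_def ray_def ..
  finally have "(\<lambda>n. integral {0..} (g n)) \<longlonglongrightarrow> JB \<delta> t lam phi" .
  moreover have "ray phi 0 = of_real (1 - \<kappa>)" by (simp add: ray_def)
  ultimately show ?thesis unfolding integral_unique[OF gi] by (simp only:)
qed

text \<open>Far out, a vertical segment joins the horizontal line to the ray, and its contribution
  tends to 0. So the ray integral differs from the contour up to the end of the diagonal by at most
  the horizontal bound.\<close>

lemma JB_bound:
  assumes P: "\<And>z. z \<in> slit_plane \<Longrightarrow> (P has_field_derivative JBf t lam z) (at z)"
    and phi: "phi_adm lam phi" and \<kappa>_eq: "\<kappa> = t powr (\<delta> - 1)"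
  shows "norm (JB \<delta> t lam phi - (P (diag (1/4)) - P (of_real (1 - \<kappa>))))
    \<le> 8 * sqrt \<kappa> / (t * \<kappa>) * exp (- (t * \<kappa> / 256))"
proof (rule tendsto_upperbound)
  note pos = phi_adm_pos[OF phi]
  define K where "K = 8 * sqrt \<kappa> / (t * \<kappa>) * exp (- (t * \<kappa> / 256))"
  define l where "l = JB \<delta> t lam phi - (P (diag (1/4)) - P (of_real (1 - \<kappa>)))"
  \<comment> \<open>On the segment 0 < Im w \<le> s sin phi. The term with \<open>ln lam\<close> is
    dropped when it is nonnegative and is smallest at the top otherwise; the minimum serves both
    cases.\<close>
  define \<mu> where "\<mu> = min (pi * cos phi) (pi * cos phi + ln lam * sin phi)"
  have \<mu>: "0 < \<mu>" using pos by (simp add: \<mu>_def)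
  define r where "r s = exp (t * 7) * exp (- (t * (\<mu> * s))) * (s * sin phi)" for s
  \<comment> \<open>The first threshold puts the segment at real part at least 4, the second puts
    the ray point above the horizontal line.\<close>
  have bound: "norm (P (ray phi s) - P (diag (1/4))) \<le> r s + K"
    if s: "4 / cos phi \<le> s" "\<kappa> / 4 / sin phi \<le> s" "0 \<le> s" for s
  proof -
    have sc: "4 \<le> s * cos phi" "\<kappa> / 4 \<le> s * sin phi"
      using s(1,2) pos by (simp_all add: divide_simps)
    define x where "x = Re (ray phi s)"
    have x: "4 \<le> x" "s * cos phi \<le> x" using sc \<kappa> by (simp_all add: x_def)
    define q where "q = Complex x (\<kappa> / 4)"
    have ka: "\<kappa> * a < 1" using \<kappa> a mult_strict_mono'[of \<kappa> 1 a 1] by simp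
    have "Re (diag (1/4)) \<le> x" using x ka \<kappa> by (simp add: diag_def)
    moreover have q: "q = diag (1/4) + of_real (x - Re (diag (1/4)))"
      by (simp add: q_def complex_eq_iff diag_def)
    ultimately have 1: "norm (P q - P (diag (1/4))) \<le> K"
      unfolding q K_def by (intro primitive_horizontal_bound P) auto
    have seg: "Re w = x \<and> \<kappa> / 4 \<le> Im w \<and> Im w \<le> s * sin phi" if "w \<in> closed_segment q (ray phi s)" for w
    proof -
      from that obtain u where u: "0 \<le> u" "u \<le> 1" "w = (1 - u) *\<^sub>R q + u *\<^sub>R ray phi s"
        by (auto simp: in_segment)
      have comb: "(1 - u) * y + u * y = y" for y by (simp add: algebra_simps)
      have Re: "Re w = (1 - u) * x + u * x" by (simp add: u(3) q_def x_def)
      have Im: "Im w = (1 - u) * (\<kappa> / 4) + u * (s * sin phi)" by (simp add: u(3) q_def)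
      have "u * (\<kappa> / 4) \<le> u * (s * sin phi)"
        using sc(2) u(1) by (rule mult_left_mono)
      then have "(1 - u) * (\<kappa> / 4) + u * (\<kappa> / 4) \<le> Im w" unfolding Im by (rule add_left_mono)
      moreover have "(1 - u) * (\<kappa> / 4) \<le> (1 - u) * (s * sin phi)"
        using sc(2) u(2) by (intro mult_left_mono) auto
      then have "Im w \<le> (1 - u) * (s * sin phi) + u * (s * sin phi)" unfolding Im by (rule add_right_mono)
      ultimately show ?thesis using Re unfolding comb by blast
    qed
    have "norm (P (ray phi s) - P q) \<le> exp (t * 7) * exp (- (t * (\<mu> * s))) * norm (ray phi s - q)"
    proof (rule field_differentiable_bound[OF convex_closed_segment])
      fix w assume w: "w \<in> closed_segment q (ray phi s)"
      have sw: "Re w = x" "\<kappa> / 4 \<le> Im w" "Im w \<le> s * sin phi"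
        using seg[OF w] by blast+
      have im: "0 < Im w" using sw(2) \<kappa>(1) by linarith
      then have "w \<in> slit_plane" by (simp add: slit_plane_def)
      then show "(P has_field_derivative JBf t lam w) (at w within closed_segment q (ray phi s))"
        by (rule has_field_derivative_at_within[OF P])
      have "\<mu> * s \<le> pi * Re w + ln lam * Im w"
      proof -
        have "\<mu> * s \<le> pi * (s * cos phi) + ln lam * Im w"
        proof (cases "ln lam \<ge> 0")
          case True
          have "\<mu> * s \<le> pi * cos phi * s" unfolding \<mu>_def using s by (intro mult_right_mono) auto
          moreover have "0 \<le> ln lam * Im w" using True im by simp
          ultimately show ?thesis by (simp add: algebra_simps)
        next
          case False
          have "\<mu> * s \<le> (pi * cos phi + ln lam * sin phi) * s"
            unfolding \<mu>_def using s by (intro mult_right_mono) auto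
          moreover have "ln lam * (s * sin phi) \<le> ln lam * Im w"
            using False sw(3) by (intro mult_left_mono_neg) auto
          ultimately show ?thesis by (simp add: algebra_simps)
        qed
        moreover have "pi * (s * cos phi) \<le> pi * Re w" unfolding sw(1) using x(2) by simp
        ultimately show ?thesis by linarith
      qed
      moreover have "4 \<le> norm w" using complex_Re_le_cmod[of w] sw(1) x(1) by linarith
      ultimately show "norm (JBf t lam w) \<le> exp (t * 7) * exp (- (t * (\<mu> * s)))"
        using im by (intro norm_JBf_far_le)
    qed auto
    also have "\<dots> \<le> r s"
    proof -
      have "ray phi s - q = \<i> * of_real (s * sin phi - \<kappa> / 4)"
        by (simp add: complex_eq_iff q_def x_def)
      then have "norm (ray phi s - q) \<le> s * sin phi" using sc \<kappa> by (simp add: norm_mult del: of_real_diff)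
      then show ?thesis unfolding r_def by (intro mult_left_mono) auto
    qed
    finally show ?thesis
      using 1 norm_triangle_ineq[of "P (ray phi s) - P q" "P q - P (diag (1/4))"] by simp
  qed
  have "(r \<longlongrightarrow> 0) at_top"
  proof -
    have "0 < t * \<mu>" using t \<mu> by simp
    then have "filterlim (\<lambda>s. t * \<mu> * s) at_top at_top"
      by (intro filterlim_tendsto_pos_mult_at_top[OF tendsto_const] filterlim_ident)
    from filterlim_compose[OF tendsto_power_div_exp_0 this, of 1]
    have "((\<lambda>s. exp (t * 7) * sin phi / (t * \<mu>) * ((t * \<mu> * s) ^ 1 / exp (t * \<mu> * s)))
        \<longlongrightarrow> exp (t * 7) * sin phi / (t * \<mu>) * 0) at_top"
      by (intro tendsto_intros)
    moreover have "exp (t * 7) * sin phi / (t * \<mu>) * ((t * \<mu> * s) ^ 1 / exp (t * \<mu> * s)) = r s" for s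
      unfolding r_def using t \<mu> by (simp add: exp_minus field_simps)
    ultimately show ?thesis by simp
  qed
  then have r: "(\<lambda>n. r (real n)) \<longlonglongrightarrow> 0"
    by (rule filterlim_compose[OF _ filterlim_real_sequentially])
  \<comment> \<open>Subtracting \<open>r\<close> before the limit leaves a sequence eventually
    bounded by the constant \<open>K\<close>, and the limit inherits this bound.\<close>
  have "(\<lambda>n. norm (P (ray phi (real n)) - P (of_real (1 - \<kappa>)) - (P (diag (1/4)) - P (of_real (1 - \<kappa>)))) - r (real n))
    \<longlonglongrightarrow> norm l - 0"
    unfolding l_def by (intro tendsto_intros JB_eq_limit[OF P phi \<kappa>_eq] r)
  then show "(\<lambda>n. norm (P (ray phi (real n)) - P (diag (1/4))) - r (real n)) \<longlonglongrightarrow> norm l"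
    by simp
  have "eventually (\<lambda>n. 4 / cos phi \<le> real n \<and> \<kappa> / 4 / sin phi \<le> real n) sequentially"
    using eventually_ge_at_top[of "nat \<lceil>4 / cos phi\<rceil>"] eventually_ge_at_top[of "nat \<lceil>\<kappa> / 4 / sin phi\<rceil>"]
    by eventually_elim linarith
  then show "eventually (\<lambda>n. norm (P (ray phi (real n)) - P (diag (1/4))) - r (real n)
      \<le> 8 * sqrt \<kappa> / (t * \<kappa>) * exp (- (t * \<kappa> / 256))) sequentially"
  proof eventually_elim
    case (elim n)
    then show ?case using bound[of "real n"] by (simp add: K_def)
  qed
qed simp

end

section \<open>The expansion with explicit scales\<close>

text \<open>Raise u \<le> exp u to the power n at u = x/(256 n). This trades exponentially small
  terms for the algebraic size of the remainder.\<close>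

lemma exp_minus_le_inverse_power:
  fixes x :: real
  assumes "0 < x" "0 < n"
  shows "exp (- (x / 256)) \<le> (256 * real n) ^ n / x ^ n"
proof -
  have "x / (256 * real n) \<le> exp (x / (256 * real n))"
    using exp_ge_add_one_self[of "x / (256 * real n)"] by linarith
  then have "(x / (256 * real n)) ^ n \<le> exp (x / (256 * real n)) ^ n"
    using assms by (intro power_mono) auto
  also have "\<dots> = exp (x / 256)"
    using assms by (simp flip: exp_of_nat_mult)
  finally show ?thesis
    using assms by (simp add: exp_minus power_divide field_simps)
qed

text \<open>\<open>C\<close> is chosen outside the locale, before its parameters, so that it cannot
  depend on them. The ball scale is \<open>r = a + y\<close>.\<close>

lemma Top_diag_bound:
  "\<exists>C\<ge>0. \<forall>\<kappa> lam a t y. steepest \<kappa> lam a t \<longrightarrow> 0 \<le> y \<longrightarrow> y \<le> 1/4 \<longrightarrow>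
    norm (Top j t lam (steepest.diag \<kappa> a y)) \<le> C * (sqrt \<kappa> / ((t * \<kappa>) ^ (j + 1) * (a + y) ^ (2 * j + 1)))"
proof -
  obtain C where C: "C \<ge> 0" and bnd: "\<And>t \<kappa> r lam p z. t > 0 \<Longrightarrow> \<kappa> > 0 \<Longrightarrow> r > 0 \<Longrightarrow> lam > 0 \<Longrightarrow>
    ball p (\<kappa> * r / 4) \<subseteq> slit_plane \<Longrightarrow>
    \<forall>z\<in>ball p (\<kappa> * r / 4). \<kappa> / 4 \<le> norm (1 - z) \<and> r / 8 \<le> norm (dFz z lam) \<Longrightarrow>
    z\<in>ball p (\<kappa> * r / 4 / 2 ^ j) \<Longrightarrow>
      norm (Top j t lam z) \<le> C * sqrt \<kappa> / ((t * \<kappa>) ^ (j + 1) * r ^ (2 * j + 1))"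
    using Top_bound[of j] by metis
  show ?thesis
  proof (intro exI[of _ C] conjI allI impI)
    fix \<kappa> lam a t y :: real
    assume "steepest \<kappa> lam a t" and y: "0 \<le> y" "y \<le> 1/4"
    then interpret steepest \<kappa> lam a t by simp
    have "a + y > 0" using a y by simp
    then show "norm (Top j t lam (diag y)) \<le> C * (sqrt \<kappa> / ((t * \<kappa>) ^ (j + 1) * (a + y) ^ (2 * j + 1)))"
      using bnd[OF t \<kappa>(1) _ lam diag_ball(1,2)[OF y], of "diag y"] \<kappa> by simp
  qed (use C in auto)
qed

lemma deriv_Top_diag_bound:
  "\<exists>C\<ge>0. \<forall>\<kappa> lam a t y. steepest \<kappa> lam a t \<longrightarrow> 0 \<le> y \<longrightarrow> y \<le> 1/4 \<longrightarrow>
    norm (deriv (Top j t lam) (steepest.diag \<kappa> a y))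
      \<le> C * sqrt \<kappa> / ((t * \<kappa>) ^ (j + 1) * \<kappa> * (a + y) ^ (2 * j + 2))"
proof -
  obtain C where C: "C \<ge> 0" and bnd: "\<And>t \<kappa> r lam p. t > 0 \<Longrightarrow> \<kappa> > 0 \<Longrightarrow> r > 0 \<Longrightarrow> lam > 0 \<Longrightarrow>
    ball p (\<kappa> * r / 4) \<subseteq> slit_plane \<Longrightarrow>
    \<forall>z\<in>ball p (\<kappa> * r / 4). \<kappa> / 4 \<le> norm (1 - z) \<and> r / 8 \<le> norm (dFz z lam) \<Longrightarrow>
      norm (deriv (Top j t lam) p) \<le> C * sqrt \<kappa> / ((t * \<kappa>) ^ (j + 1) * \<kappa> * r ^ (2 * j + 2))"
    using deriv_Top_bound[of j] by metis
  show ?thesis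
  proof (intro exI[of _ C] conjI allI impI)
    fix \<kappa> lam a t y :: real
    assume "steepest \<kappa> lam a t" and y: "0 \<le> y" "y \<le> 1/4"
    then interpret steepest \<kappa> lam a t by simp
    have "a + y > 0" using a y by simp
    then show "norm (deriv (Top j t lam) (diag y))
        \<le> C * sqrt \<kappa> / ((t * \<kappa>) ^ (j + 1) * \<kappa> * (a + y) ^ (2 * j + 2))"
      by (rule bnd[OF t \<kappa>(1) _ lam diag_ball(1,2)[OF y]])
  qed (use C in auto)
qed

lemma (in steepest) Tj_eq: "Tj j t lam (\<kappa> * (1 - a)) = - Sj j t lam (diag 0)"
  by (simp only: Tj_def Sj_def diag_0)

lemma Tj_bound:
  "\<exists>C\<ge>0. \<forall>\<kappa> lam a t. steepest \<kappa> lam a t \<longrightarrow>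
    norm (Tj j t lam (\<kappa> * (1 - a))) \<le> C * (sqrt \<kappa> / ((t * \<kappa>) ^ (j + 1) * a ^ (2 * j + 1)))"
proof -
  obtain C where C: "C \<ge> 0" and bnd: "\<And>\<kappa> lam a t y. steepest \<kappa> lam a t \<Longrightarrow> 0 \<le> y \<Longrightarrow> y \<le> 1/4 \<Longrightarrow>
    norm (Top j t lam (steepest.diag \<kappa> a y)) \<le> C * (sqrt \<kappa> / ((t * \<kappa>) ^ (j + 1) * (a + y) ^ (2 * j + 1)))"
    using Top_diag_bound[of j] by metis
  show ?thesis
  proof (intro exI[of _ C] conjI allI impI)
    fix \<kappa> lam a t :: real
    assume st: "steepest \<kappa> lam a t"
    then interpret steepest \<kappa> lam a t .
    have "norm (Tj j t lam (\<kappa> * (1 - a))) \<le> norm (Top j t lam (diag 0)) * 1"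
      unfolding Tj_eq Sj_def norm_minus_cancel norm_mult
      by (intro mult_left_mono norm_exp_Fz_diag) auto
    also have "\<dots> \<le> C * (sqrt \<kappa> / ((t * \<kappa>) ^ (j + 1) * a ^ (2 * j + 1)))"
      using bnd[OF st, of 0] by simp
    finally show "norm (Tj j t lam (\<kappa> * (1 - a))) \<le> C * (sqrt \<kappa> / ((t * \<kappa>) ^ (j + 1) * a ^ (2 * j + 1)))" .
  qed (use C in auto)
qed

text \<open>At the end of the diagonal \<open>a + y\<close> exceeds 1/4, so no negative power of a
  occurs and the exponential supplies the decay.\<close>

lemma Sj_end_bound:
  "\<exists>C\<ge>0. \<forall>\<kappa> lam a t. steepest \<kappa> lam a t \<longrightarrow> 1 \<le> t * \<kappa> \<longrightarrow>
    norm (Sj j t lam (steepest.diag \<kappa> a (1/4))) \<le> C * (sqrt \<kappa> * exp (- (t * \<kappa> / 256)))"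
proof -
  obtain C where C: "C \<ge> 0" and bnd: "\<And>\<kappa> lam a t y. steepest \<kappa> lam a t \<Longrightarrow> 0 \<le> y \<Longrightarrow> y \<le> 1/4 \<Longrightarrow>
    norm (Top j t lam (steepest.diag \<kappa> a y)) \<le> C * (sqrt \<kappa> / ((t * \<kappa>) ^ (j + 1) * (a + y) ^ (2 * j + 1)))"
    using Top_diag_bound[of j] by metis
  show ?thesis
  proof (intro exI[of _ "C * 4 ^ (2 * j + 1)"] conjI allI impI)
    fix \<kappa> lam a t :: real
    assume st: "steepest \<kappa> lam a t" and ge: "1 \<le> t * \<kappa>"
    from st interpret steepest \<kappa> lam a t .
    have "norm (Top j t lam (diag (1/4))) \<le> C * (sqrt \<kappa> / ((t * \<kappa>) ^ (j + 1) * (a + 1/4) ^ (2 * j + 1)))"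
      using bnd[OF st, of "1/4"] by simp
    also have "\<dots> \<le> C * (sqrt \<kappa> / (1 * (1/4) ^ (2 * j + 1)))"
      using C \<kappa> a ge by (intro mult_left_mono divide_left_mono mult_mono power_mono one_le_power) auto
    also have "\<dots> = C * 4 ^ (2 * j + 1) * sqrt \<kappa>"
      by (simp add: power_divide)
    finally have T: "norm (Top j t lam (diag (1/4))) \<le> C * 4 ^ (2 * j + 1) * sqrt \<kappa>" .
    have "\<kappa> / 256 \<le> Im (Fz (diag (1/4)) lam)"
      using Im_Fz_diag[of "1/4"] by (simp add: power2_eq_square)
    then have "t * (\<kappa> / 256) \<le> t * Im (Fz (diag (1/4)) lam)"
      using t by (intro mult_left_mono) auto
    then have "norm (Sj j t lam (diag (1/4))) \<le> C * 4 ^ (2 * j + 1) * sqrt \<kappa> * exp (- (t * \<kappa> / 256))"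
      unfolding Sj_def norm_mult norm_exp_Fz using C \<kappa> by (intro mult_mono T) auto
    then show "norm (Sj j t lam (diag (1/4))) \<le> C * 4 ^ (2 * j + 1) * (sqrt \<kappa> * exp (- (t * \<kappa> / 256)))"
      by (simp add: mult.assoc)
  qed (use C in auto)
qed

text \<open>Integration by parts runs through the indices up to N while only those below N are kept;
  the term of index N has the size of the remainder and joins the error.\<close>

lemma JB_expansion_bound:
  "\<exists>C\<ge>0. \<forall>\<kappa> lam a t \<delta> phi. steepest \<kappa> lam a t \<longrightarrow> 1 \<le> t * \<kappa> \<longrightarrow> \<kappa> \<le> 1/2 \<longrightarrow>
    phi_adm lam phi \<longrightarrow> \<kappa> = t powr (\<delta> - 1) \<longrightarrow>
    norm (JB \<delta> t lam phi - (\<Sum>j<N. Tj j t lam (\<kappa> * (1 - a)))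
      - exp (\<i> * of_real t * Fz (of_real (1 - \<kappa>)) lam - \<i> * of_real ((steepest.om \<kappa> lam t)\<^sup>2))
        * of_real (sqrt \<kappa> / steepest.S \<kappa> t)
        * integral {steepest.om \<kappa> lam t..steepest.om \<kappa> lam t + a * steepest.S \<kappa> t} (\<lambda>\<xi>. exp (\<i> * of_real (\<xi>\<^sup>2))))
    \<le> C * (sqrt \<kappa> / ((t * \<kappa>) ^ (N + 1) * a ^ (2 * N + 1)) + sqrt \<kappa> * (a\<^sup>2 + t * \<kappa> * a ^ 4))"
proof -
  obtain CD where CD: "CD \<ge> 0" and bD: "\<And>\<kappa> lam a t y. steepest \<kappa> lam a t \<Longrightarrow> 0 \<le> y \<Longrightarrow> y \<le> 1/4 \<Longrightarrow>
    norm (deriv (Top N t lam) (steepest.diag \<kappa> a y))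
      \<le> CD * sqrt \<kappa> / ((t * \<kappa>) ^ (N + 1) * \<kappa> * (a + y) ^ (2 * N + 2))"
    using deriv_Top_diag_bound[of N] by metis
  obtain CT where CT: "CT \<ge> 0" and bT: "\<And>\<kappa> lam a t. steepest \<kappa> lam a t \<Longrightarrow>
    norm (Tj N t lam (\<kappa> * (1 - a))) \<le> CT * (sqrt \<kappa> / ((t * \<kappa>) ^ (N + 1) * a ^ (2 * N + 1)))"
    using Tj_bound[of N] by metis
  obtain CS where CS: "\<And>j. CS j \<ge> 0" and bS: "\<And>j \<kappa> lam a t. steepest \<kappa> lam a t \<Longrightarrow> 1 \<le> t * \<kappa> \<Longrightarrow>
    norm (Sj j t lam (steepest.diag \<kappa> a (1/4))) \<le> CS j * (sqrt \<kappa> * exp (- (t * \<kappa> / 256)))"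
    using Sj_end_bound by metis
  define E where "E = (256 * real (N + 1)) ^ (N + 1)"
  have E: "E \<ge> 0" by (simp add: E_def)
  define CE where "CE = (\<Sum>j<Suc N. CS j) + 8"
  have CE: "CE \<ge> 0" unfolding CE_def using CS by (intro add_nonneg_nonneg sum_nonneg) auto
  show ?thesis
  proof (intro exI[of _ "2 * CD + CT + CE * E + 1"] conjI allI impI)
    fix \<kappa> lam a t \<delta> phi :: real
    assume st: "steepest \<kappa> lam a t" and ge: "1 \<le> t * \<kappa>" and half: "\<kappa> \<le> 1/2"
      and phi: "phi_adm lam phi" and \<kappa>_eq: "\<kappa> = t powr (\<delta> - 1)"
    from st interpret steepest \<kappa> lam a t .
    obtain P where P: "\<And>z. z \<in> slit_plane \<Longrightarrow> (P has_field_derivative JBf t lam z) (at z)"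
      using JBf_primitive[OF lam] by metis
    define M where "M = exp (\<i> * of_real t * Fz (of_real (1 - \<kappa>)) lam - \<i> * of_real (om\<^sup>2)) * of_real (sqrt \<kappa> / S)
        * integral {om..om + a * S} (\<lambda>\<xi>. exp (\<i> * of_real (\<xi>\<^sup>2)))"
    define e where "e = sqrt \<kappa> * exp (- (t * \<kappa> / 256))"
    define X where "X = sqrt \<kappa> / ((t * \<kappa>) ^ (N + 1) * a ^ (2 * N + 1))"
    define Y where "Y = sqrt \<kappa> * (a\<^sup>2 + t * \<kappa> * a ^ 4)"
    define d0 where "d0 = diag 0"
    define d1 where "d1 = diag (1/4)"
    have e0: "0 \<le> e" using \<kappa> by (simp add: e_def)
    have X0: "0 \<le> X" using \<kappa> a t by (simp add: X_def)
    have Y0: "0 \<le> Y" using \<kappa> a t by (simp add: Y_def)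
    \<comment> \<open>The exponent N + 1 is chosen to match the denominator of \<open>X\<close>; as
      a \<le> 1, the power of a may then be inserted.\<close>
    have eX: "e \<le> E * X"
    proof -
      have "e \<le> sqrt \<kappa> * (E / (t * \<kappa>) ^ (N + 1))"
        unfolding e_def E_def using \<kappa> ge by (intro mult_left_mono exp_minus_le_inverse_power) auto
      also have "\<dots> = E * (sqrt \<kappa> / ((t * \<kappa>) ^ (N + 1) * 1))" by simp
      also have "\<dots> \<le> E * X"
        unfolding X_def using \<kappa> a ge E
        by (intro mult_left_mono divide_left_mono power_le_one mult_pos_pos) auto
      finally show ?thesis .
    qed
    have 1: "norm (JB \<delta> t lam phi - (P d1 - P (of_real (1 - \<kappa>)))) \<le> 8 * e"
    proof -
      have "8 * sqrt \<kappa> / (t * \<kappa>) * exp (- (t * \<kappa> / 256)) \<le> 8 * sqrt \<kappa> / 1 * exp (- (t * \<kappa> / 256))"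
        using \<kappa> ge by (intro mult_right_mono divide_left_mono) auto
      with JB_bound[OF P phi \<kappa>_eq] show ?thesis unfolding e_def d1_def by simp
    qed
    have 2: "norm ((P d1 - (\<Sum>j<Suc N. Sj j t lam d1)) - (P d0 - (\<Sum>j<Suc N. Sj j t lam d0))) \<le> 2 * CD * X"
      unfolding X_def d0_def d1_def using primitive_diag_bound[OF P CD bD[OF st]] by simp
    have 3: "norm (\<Sum>j<Suc N. Sj j t lam d1) \<le> (\<Sum>j<Suc N. CS j) * e"
      unfolding e_def sum_distrib_right d1_def by (intro norm_sum[THEN order.trans] sum_mono bS[OF st ge])
    have 4: "norm (Tj N t lam (\<kappa> * (1 - a))) \<le> CT * X"
      unfolding X_def by (rule bT[OF st])
    have 5: "norm (P d0 - P (of_real (1 - \<kappa>)) - M) \<le> Y"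
      unfolding M_def Y_def d0_def by (rule stationary_piece_bound[OF P half])
    \<comment> \<open>The five pieces are the deformation error, the remainder on the diagonal, the
      boundary terms at its far end, the extra term at its near end, and the real piece against the
      Fresnel term.\<close>
    have "JB \<delta> t lam phi - (\<Sum>j<N. Tj j t lam (\<kappa> * (1 - a))) - M
      = (JB \<delta> t lam phi - (P d1 - P (of_real (1 - \<kappa>))))
        + ((P d1 - (\<Sum>j<Suc N. Sj j t lam d1)) - (P d0 - (\<Sum>j<Suc N. Sj j t lam d0)))
        + (\<Sum>j<Suc N. Sj j t lam d1) + Tj N t lam (\<kappa> * (1 - a))
        + (P d0 - P (of_real (1 - \<kappa>)) - M)"
    proof -
      have "(\<Sum>j<N. Tj j t lam (\<kappa> * (1 - a))) = - (\<Sum>j<N. Sj j t lam d0)"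
        by (simp add: Tj_eq sum_negf d0_def)
      moreover have "Tj N t lam (\<kappa> * (1 - a)) = - Sj N t lam d0" by (simp add: Tj_eq d0_def)
      ultimately show ?thesis by simp
    qed
    also have "norm \<dots> \<le> 8 * e + 2 * CD * X + (\<Sum>j<Suc N. CS j) * e + CT * X + Y"
      by (intro norm_triangle_mono 1 2 3 4 5)
    also have "\<dots> = (2 * CD + CT) * X + CE * e + Y"
      by (simp add: CE_def algebra_simps)
    also have "\<dots> \<le> (2 * CD + CT) * X + CE * (E * X) + Y"
      using eX CE by (simp add: mult_left_mono)
    also have "\<dots> \<le> (2 * CD + CT + CE * E + 1) * (X + Y)"
    proof -
      have "0 \<le> (2 * CD + CT + CE * E) * Y" using CD CT CE E Y0 by simp
      then show ?thesis using X0 by (simp add: algebra_simps)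
    qed
    finally show "norm (JB \<delta> t lam phi - (\<Sum>j<N. Tj j t lam (\<kappa> * (1 - a)))
      - exp (\<i> * of_real t * Fz (of_real (1 - \<kappa>)) lam - \<i> * of_real (om\<^sup>2)) * of_real (sqrt \<kappa> / S)
        * integral {om..om + a * S} (\<lambda>\<xi>. exp (\<i> * of_real (\<xi>\<^sup>2))))
      \<le> (2 * CD + CT + CE * E + 1)
        * (sqrt \<kappa> / ((t * \<kappa>) ^ (N + 1) * a ^ (2 * N + 1)) + sqrt \<kappa> * (a\<^sup>2 + t * \<kappa> * a ^ 4))"
      unfolding M_def X_def Y_def .
  qed (use CD CT CE E in simp)
qed

section \<open>Conversion of the scales into powers of t\<close>

lemma T_scale:
  fixes t \<delta> a :: real
  assumes t: "t > 0" and a: "a > 0"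
  shows "sqrt (t powr (\<delta> - 1)) / ((t * t powr (\<delta> - 1)) ^ (j + 1) * a ^ (2 * j + 1))
    = t powr (-1/2 - real (2 * j + 1) * \<delta> / 2) / a ^ (2 * j + 1)"
proof -
  have "t * t powr (\<delta> - 1) = t powr \<delta>"
    using t by (simp add: powr_mult_base)
  then have "(t * t powr (\<delta> - 1)) ^ (j + 1) = (t powr \<delta>) powr real (j + 1)"
    using t by (subst powr_realpow) auto
  then have p: "(t * t powr (\<delta> - 1)) ^ (j + 1) = t powr (\<delta> * real (j + 1))"
    by (simp only: powr_powr)
  have "sqrt (t powr (\<delta> - 1)) = t powr ((\<delta> - 1) / 2)"
    using t by (simp add: powr_powr flip: powr_half_sqrt)
  then have "sqrt (t powr (\<delta> - 1)) / (t * t powr (\<delta> - 1)) ^ (j + 1)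
      = t powr ((\<delta> - 1) / 2 - \<delta> * real (j + 1))"
    unfolding p by (simp only: powr_diff)
  also have "(\<delta> - 1) / 2 - \<delta> * real (j + 1) = -1/2 - real (2 * j + 1) * \<delta> / 2"
    by (simp add: field_simps)
  finally show ?thesis by (metis divide_divide_eq_left)
qed

text \<open>The remainder has the size of the first omitted boundary term; the upper bound on \<open>a\<close>
  is exactly what absorbs it into the stated error.\<close>
lemma T_absorbed:
  fixes t \<delta> a :: real
  assumes t: "t > 0" and a: "a > 0" and m: "m \<ge> 2"
    and le: "a \<le> t powr (-\<delta>/2 + \<delta> / (4 * real m - 2))"
  shows "t powr (-1/2 - real (2 * (m - 2) + 1) * \<delta> / 2) / a ^ (2 * (m - 2) + 1)
    \<le> t powr (-1/2 - real (4 * m - 5) * \<delta> / 2) / a ^ (4 * m - 4)"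
proof -
  have "a ^ (2 * m - 1) \<le> (t powr (-\<delta>/2 + \<delta> / (4 * real m - 2))) ^ (2 * m - 1)"
    using a le by (intro power_mono) auto
  also have "\<dots> = t powr ((-\<delta>/2 + \<delta> / (4 * real m - 2)) * real (2 * m - 1))"
    using t by (simp add: powr_powr flip: powr_realpow)
  also have "(-\<delta>/2 + \<delta> / (4 * real m - 2)) * real (2 * m - 1) = - (real m - 1) * \<delta>"
  proof -
    have "real (2 * m - 1) = 2 * real m - 1" using m by simp
    moreover have "4 * real m - 2 \<noteq> 0" using m by simp
    ultimately show ?thesis by (simp add: field_simps)
  qed
  finally have p: "a ^ (2 * m - 1) \<le> t powr (- (real m - 1) * \<delta>)" .
  have "t powr (-1/2 - real (2 * (m - 2) + 1) * \<delta> / 2) * a ^ (2 * m - 1)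
    \<le> t powr (-1/2 - real (2 * (m - 2) + 1) * \<delta> / 2) * t powr (- (real m - 1) * \<delta>)"
    by (intro mult_left_mono p) auto
  also have "\<dots> = t powr (-1/2 - real (4 * m - 5) * \<delta> / 2)"
  proof -
    have "real (2 * (m - 2) + 1) = 2 * real m - 3" "real (4 * m - 5) = 4 * real m - 5"
      using m by simp_all
    then show ?thesis by (simp add: field_simps flip: powr_add)
  qed
  finally have "t powr (-1/2 - real (2 * (m - 2) + 1) * \<delta> / 2) * a ^ (2 * m - 1) / a ^ (4 * m - 4)
    \<le> t powr (-1/2 - real (4 * m - 5) * \<delta> / 2) / a ^ (4 * m - 4)"
    using a by (intro divide_right_mono) auto
  moreover have "a ^ (4 * m - 4) = a ^ (2 * (m - 2) + 1) * a ^ (2 * m - 1)"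
  proof -
    have "4 * m - 4 = (2 * (m - 2) + 1) + (2 * m - 1)" using m by simp
    then show ?thesis by (simp only: power_add)
  qed
  ultimately show ?thesis using a by simp
qed

lemma dfact_ge_1: "1 \<le> real (dfact n)"
proof -
  have "1 \<le> dfact n" by (induction n rule: dfact.induct) auto
  then show ?thesis by linarith
qed

text \<open>The exponent -\<delta>/2 + \<delta>/(4m - 2) is negative, so the upper growth condition
  forces a to 0. The bound 3 \<le> t serves to get ln t \<ge> 1.\<close>

lemma eventually_admissible:
  fixes \<delta> :: real and m :: nat and a :: "real \<Rightarrow> real"
  assumes \<delta>: "0 < \<delta>" "\<delta> < 1" and m: "m \<ge> 4"
    and pos: "eventually (\<lambda>t. a t > 0) at_top"
    and lower: "((\<lambda>t. t powr (-\<delta>/2) / a t) \<longlongrightarrow> 0) at_top"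
    and upper: "((\<lambda>t. a t / t powr (-\<delta>/2 + \<delta> / (4 * real m - 2))) \<longlongrightarrow> 0) at_top"
  shows "eventually (\<lambda>t. 0 < a t \<and> a t \<le> 1/8 \<and> t powr (-\<delta>/2) \<le> a t
    \<and> a t \<le> t powr (-\<delta>/2 + \<delta> / (4 * real m - 2)) \<and> t powr (\<delta> - 1) \<le> 1/2 \<and> 3 \<le> t) at_top"
proof -
  have neg: "-\<delta>/2 + \<delta> / (4 * real m - 2) < 0"
  proof -
    have "\<delta> / (4 * real m - 2) < \<delta> / 2" using \<delta> m by (intro divide_strict_left_mono) auto
    then show ?thesis by simp
  qed
  have "eventually (\<lambda>t::real. t powr (-\<delta>/2 + \<delta> / (4 * real m - 2)) < 1/8) at_top"
    using order_tendstoD(2)[OF tendsto_neg_powr[OF neg filterlim_ident], of "1/8"] by simp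
  moreover have "eventually (\<lambda>t::real. t powr (\<delta> - 1) < 1/2) at_top"
    using order_tendstoD(2)[OF tendsto_neg_powr[OF _ filterlim_ident, of "\<delta> - 1"], of "1/2"] \<delta> by simp
  moreover have "eventually (\<lambda>t. t powr (-\<delta>/2) / a t < 1) at_top"
    using order_tendstoD(2)[OF lower, of 1] by simp
  moreover have "eventually (\<lambda>t. a t / t powr (-\<delta>/2 + \<delta> / (4 * real m - 2)) < 1) at_top"
    using order_tendstoD(2)[OF upper, of 1] by simp
  ultimately show ?thesis
    using pos eventually_ge_at_top[of "3::real"]
    by eventually_elim (auto simp: divide_less_eq)
qed

theorem theorem1p5:
  fixes \<delta> :: real and m :: nat and a :: "real \<Rightarrow> real"
  assumes "0 < \<delta>" "\<delta> < 1" "m \<ge> 4"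
    and "eventually (\<lambda>t. a t > 0) at_top"
    and "((\<lambda>t. t powr (-\<delta>/2) / a t) \<longlongrightarrow> 0) at_top"
    and "\<exists>\<epsilon>>0. ((\<lambda>t. t powr (\<epsilon> - \<delta>/2 + \<delta>/(4*m+2)) / a t) \<longlongrightarrow> 0) at_top
              \<and> ((\<lambda>t. a t / t powr (-\<delta>/2 + \<delta>/(4*m-2))) \<longlongrightarrow> 0) at_top"
  shows
   "(\<exists>C T0. \<forall>t \<ge> T0. \<forall>lam phi.
       let lc = 1 / (t powr (1 - \<delta>) - 1);
           \<Lambda> = lam / lc - 1;
           \<omega> = sqrt (lc * t / 2) * ln (1 + \<Lambda>) / (1 + lc);
           k = t powr (\<delta> - 1) * (1 - a t)
       in t > 1 \<and> lc \<le> lam \<and> lam \<le> t powr (1 - \<delta>) - 1 \<and> phi_adm lam phi \<longrightarrow>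
          norm (JB \<delta> t lam phi - (\<Sum>j=0..m-3. Tj j t lam k)
                - exp (\<i> * of_real t * Fz (of_real (1 - t powr (\<delta> - 1))) lam - \<i> * of_real (\<omega>^2))
                  * of_real (t powr (-1/2) * sqrt (2 / (1 + lc)))
                  * integral {\<omega>..\<omega> + a t * sqrt (lc * t / 2)} (\<lambda>\<xi>. exp (\<i> * of_real (\<xi>^2))))
          \<le> C * (real (dfact (4*m-5)) * t powr (-1/2 - real (4*m-5) * \<delta> / 2)
                   * ln t powr ((real (4*m) - 3) / 2) / a t ^ (4*m-4)
                 + t powr (-1/2 + 3*\<delta>/2) * a t ^ 4))
    \<and> (\<forall>j. \<exists>C T0. \<forall>t \<ge> T0. \<forall>lam.
       let lc = 1 / (t powr (1 - \<delta>) - 1);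
           k = t powr (\<delta> - 1) * (1 - a t)
       in t > 1 \<and> lc \<le> lam \<and> lam \<le> t powr (1 - \<delta>) - 1 \<longrightarrow>
          norm (Tj j t lam k)
          \<le> C * (real (dfact (2*j-1)) * t powr (-1/2 - real (2*j+1) * \<delta> / 2) / a t ^ (2*j+1)))"
proof -
  \<comment> \<open>For m \<ge> 4 the truncated subtraction agrees with the real one.\<close>
  have "real (4 * m - 2) = 4 * real m - 2" using assms(3) by simp
  with assms(6) have upper: "((\<lambda>t. a t / t powr (-\<delta>/2 + \<delta> / (4 * real m - 2))) \<longlongrightarrow> 0) at_top"
    by auto
  obtain T0 where T0: "\<And>t. T0 \<le> t \<Longrightarrow> 0 < a t \<and> a t \<le> 1/8 \<and> t powr (-\<delta>/2) \<le> a t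
    \<and> a t \<le> t powr (-\<delta>/2 + \<delta> / (4 * real m - 2)) \<and> t powr (\<delta> - 1) \<le> 1/2 \<and> 3 \<le> t"
    using eventually_admissible[OF assms(1-5) upper] unfolding eventually_at_top_linorder by blast
  \<comment> \<open>Since \<open>t powr (1 - \<delta>)\<close> is 1/\<kappa>, the critical value
    \<lambda>_c equals \<kappa>/(1 - \<kappa>), the lower bound in the locale.\<close>
  have st: "steepest (t powr (\<delta> - 1)) lam (a t) t"
    if "T0 \<le> t" "1 / (t powr (1 - \<delta>) - 1) \<le> lam" for t lam
  proof
    note T = T0[OF that(1)]
    show "0 < t powr (\<delta> - 1)" "t powr (\<delta> - 1) < 1" "0 < a t" "a t \<le> 1/8" "0 < t"
      using T by auto
    have "t powr (1 - \<delta>) = 1 / t powr (\<delta> - 1)"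
      using T powr_minus_divide[of t "\<delta> - 1"] by simp
    with that(2) T show "t powr (\<delta> - 1) / (1 - t powr (\<delta> - 1)) \<le> lam"
      by (simp add: divide_simps split: if_splits)
  qed
  show ?thesis
  proof (intro conjI allI)
    obtain C where C: "C \<ge> 0" and bnd: "\<And>\<kappa> lam a t \<delta> phi. steepest \<kappa> lam a t \<Longrightarrow> 1 \<le> t * \<kappa> \<Longrightarrow> \<kappa> \<le> 1/2 \<Longrightarrow>
      phi_adm lam phi \<Longrightarrow> \<kappa> = t powr (\<delta> - 1) \<Longrightarrow>
      norm (JB \<delta> t lam phi - (\<Sum>j<m-2. Tj j t lam (\<kappa> * (1 - a)))
        - exp (\<i> * of_real t * Fz (of_real (1 - \<kappa>)) lam - \<i> * of_real ((steepest.om \<kappa> lam t)\<^sup>2))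
          * of_real (sqrt \<kappa> / steepest.S \<kappa> t)
          * integral {steepest.om \<kappa> lam t..steepest.om \<kappa> lam t + a * steepest.S \<kappa> t} (\<lambda>\<xi>. exp (\<i> * of_real (\<xi>\<^sup>2))))
      \<le> C * (sqrt \<kappa> / ((t * \<kappa>) ^ (m - 2 + 1) * a ^ (2 * (m - 2) + 1)) + sqrt \<kappa> * (a\<^sup>2 + t * \<kappa> * a ^ 4))"
      using JB_expansion_bound[of "m - 2"] by blast
    have key: "norm (JB \<delta> t lam phi - (\<Sum>j=0..m-3. Tj j t lam (t powr (\<delta> - 1) * (1 - a t)))
                - exp (\<i> * of_real t * Fz (of_real (1 - t powr (\<delta> - 1))) lam - \<i> * of_real (\<omega>^2))
                  * of_real (t powr (-1/2) * sqrt (2 / (1 + lc)))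
                  * integral {\<omega>..\<omega> + a t * sqrt (lc * t / 2)} (\<lambda>\<xi>. exp (\<i> * of_real (\<xi>^2))))
          \<le> 2 * C * (real (dfact (4*m-5)) * t powr (-1/2 - real (4*m-5) * \<delta> / 2)
                   * ln t powr ((real (4*m) - 3) / 2) / a t ^ (4*m-4)
                 + t powr (-1/2 + 3*\<delta>/2) * a t ^ 4)"
      if lc_def: "lc = 1 / (t powr (1 - \<delta>) - 1)"
        and omega: "\<omega> = sqrt (lc * t / 2) * ln (1 + (lam / lc - 1)) / (1 + lc)"
        and t: "T0 \<le> t" and lam_ge: "lc \<le> lam" and phi: "phi_adm lam phi"
      for t lam phi lc \<omega>
    proof -
      define \<kappa> where "\<kappa> = t powr (\<delta> - 1)"
      define b where "b = a t"
      note T = T0[OF t, folded \<kappa>_def b_def]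
      interpret steepest \<kappa> lam b t
        unfolding \<kappa>_def b_def by (rule st[OF t lam_ge[unfolded lc_def]])
      have t0: "0 < t" using T by simp
      have half: "\<kappa> \<le> 1/2" using T by simp
      have tk: "t * \<kappa> = t powr \<delta>"
        using T by (simp add: \<kappa>_def powr_mult_base)
      have ge: "1 \<le> t * \<kappa>" unfolding tk using T assms(1) by (intro ge_one_powr_ge_zero) auto
      have tkappa: "t powr (1 - \<delta>) = 1 / \<kappa>"
        unfolding \<kappa>_def using T powr_minus_divide[of t "\<delta> - 1"] by simp
      have lc: "lc = \<kappa> / (1 - \<kappa>)" unfolding lc_def tkappa using \<kappa> by (simp add: divide_simps)
      have lc1: "1 / (1 + lc) = 1 - \<kappa>" unfolding lc using \<kappa> by (simp add: divide_simps)
      have S_eq: "sqrt (lc * t / 2) = S" unfolding lc S_def by (simp add: mult.commute)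
      have om_eq: "\<omega> = om"
      proof -
        have "lam / lc = lam * (1 - \<kappa>) / \<kappa>" unfolding lc by simp
        then have "ln (1 + (lam / lc - 1)) = L" by (simp add: L_def)
        then have "\<omega> = S * L * (1 / (1 + lc))"
          unfolding omega S_eq by simp
        then show ?thesis unfolding lc1 om_def .
      qed
      have amp: "t powr (-1/2) * sqrt (2 / (1 + lc)) = sqrt \<kappa> / S"
      proof -
        have "t powr (-1/2) * sqrt (2 / (1 + lc)) = sqrt (2 * (1 / (1 + lc)) / t)"
          unfolding powr_minus_half_eq[OF less_imp_le[OF t0]]
          by (simp add: real_sqrt_divide real_sqrt_mult)
        also have "2 * (1 / (1 + lc)) / t = \<kappa> / (t * \<kappa> / (2 * (1 - \<kappa>)))"
          unfolding lc1 using \<kappa> T by (simp add: divide_simps)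
        finally show ?thesis by (simp only: S_def real_sqrt_divide)
      qed
      \<comment> \<open>The expansion is used with N = m - 2; the closed range up to m - 3 has the
        same indices because m \<ge> 4.\<close>
      have sums: "(\<Sum>j=0..m-3. Tj j t lam (\<kappa> * (1 - b))) = (\<Sum>j<m-2. Tj j t lam (\<kappa> * (1 - b)))"
        using assms(3) by (intro sum.cong) auto
      define X where "X = t powr (-1/2 - real (4*m-5) * \<delta> / 2) / b ^ (4*m-4)"
      define Y where "Y = t powr (-1/2 + 3*\<delta>/2) * b ^ 4"
      have X0: "0 \<le> X" using a by (simp add: X_def)
      have first: "sqrt \<kappa> / ((t * \<kappa>) ^ (m - 2 + 1) * b ^ (2 * (m - 2) + 1)) \<le> X"
        unfolding X_def \<kappa>_def T_scale[OF t0 a(1)]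
        using T assms(3) by (intro T_absorbed) auto
      \<comment> \<open>The amplitude error b^2 is absorbed by the phase error: b \<ge>
        \<open>t powr (-\<delta>/2)\<close> means 1 \<le> t \<kappa> b^2.\<close>
      have second: "sqrt \<kappa> * (b\<^sup>2 + t * \<kappa> * b ^ 4) \<le> 2 * Y"
      proof -
        have "t powr (-\<delta>/2) * t powr (-\<delta>/2) \<le> b * b"
          using T by (intro mult_mono) auto
        then have "t powr (-\<delta>) \<le> b\<^sup>2" by (simp add: power2_eq_square flip: powr_add)
        then have "t powr \<delta> * t powr (-\<delta>) \<le> t powr \<delta> * b\<^sup>2" by (intro mult_left_mono) auto
        then have "1 \<le> t * \<kappa> * b\<^sup>2" unfolding tk using T by (simp flip: powr_add)
        then have "1 * b\<^sup>2 \<le> t * \<kappa> * b\<^sup>2 * b\<^sup>2" by (intro mult_right_mono) auto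
        then have "b\<^sup>2 \<le> t * \<kappa> * b ^ 4" by (simp add: mult.assoc flip: power_add)
        then have "b\<^sup>2 + t * \<kappa> * b ^ 4 \<le> 2 * (t * \<kappa> * b ^ 4)" by linarith
        then have "sqrt \<kappa> * (b\<^sup>2 + t * \<kappa> * b ^ 4) \<le> sqrt \<kappa> * (2 * (t * \<kappa> * b ^ 4))"
          using \<kappa> by (intro mult_left_mono) auto
        also have "\<dots> = 2 * (sqrt \<kappa> * t powr \<delta> * b ^ 4)" unfolding tk by simp
        also have "sqrt \<kappa> * t powr \<delta> = t powr (-1/2 + 3*\<delta>/2)"
        proof -
          have "sqrt \<kappa> = t powr ((\<delta> - 1) / 2)"
            unfolding \<kappa>_def using T by (simp add: powr_powr flip: powr_half_sqrt)
          then show ?thesis by (simp add: field_simps flip: powr_add)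
        qed
        finally show ?thesis unfolding Y_def .
      qed
      \<comment> \<open>As t \<ge> 3 > e, these factors of the stated error have product at least 1,
        so inserting them only enlarges the bound.\<close>
      have logs: "1 \<le> real (dfact (4*m-5)) * ln t powr ((real (4*m) - 3) / 2)"
      proof -
        have "exp 1 \<le> t" using T e_less_272 by simp
        then have "1 \<le> ln t" using T by (subst ln_ge_iff) auto
        then have "1 \<le> ln t powr ((real (4*m) - 3) / 2)"
          using assms(3) by (intro ge_one_powr_ge_zero) auto
        with dfact_ge_1[of "4*m-5"] show ?thesis by (rule mult_ge1_I)
      qed
      have "norm (JB \<delta> t lam phi - (\<Sum>j<m-2. Tj j t lam (\<kappa> * (1 - b)))
        - exp (\<i> * of_real t * Fz (of_real (1 - \<kappa>)) lam - \<i> * of_real (om\<^sup>2)) * of_real (sqrt \<kappa> / S)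
          * integral {om..om + b * S} (\<lambda>\<xi>. exp (\<i> * of_real (\<xi>\<^sup>2))))
        \<le> C * (sqrt \<kappa> / ((t * \<kappa>) ^ (m - 2 + 1) * b ^ (2 * (m - 2) + 1)) + sqrt \<kappa> * (b\<^sup>2 + t * \<kappa> * b ^ 4))"
        by (rule bnd[OF steepest_axioms ge half phi \<kappa>_def])
      also have "\<dots> \<le> C * (X + 2 * Y)"
        by (intro mult_left_mono add_mono first second C)
      also have "\<dots> \<le> C * (2 * ((real (dfact (4*m-5)) * ln t powr ((real (4*m) - 3) / 2)) * X + Y))"
      proof (rule mult_left_mono[OF _ C])
        have "1 * X \<le> (real (dfact (4*m-5)) * ln t powr ((real (4*m) - 3) / 2)) * X"
          by (rule mult_right_mono[OF logs X0])
        then show "X + 2 * Y \<le> 2 * ((real (dfact (4*m-5)) * ln t powr ((real (4*m) - 3) / 2)) * X + Y)"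
          using X0 by simp
      qed
      also have "\<dots> = 2 * C * (real (dfact (4*m-5)) * t powr (-1/2 - real (4*m-5) * \<delta> / 2)
                   * ln t powr ((real (4*m) - 3) / 2) / b ^ (4*m-4) + t powr (-1/2 + 3*\<delta>/2) * b ^ 4)"
        by (simp add: X_def Y_def mult_ac)
      finally show ?thesis
        unfolding \<kappa>_def[symmetric] b_def[symmetric] om_eq amp sums S_eq .
    qed
    show "\<exists>C T0. \<forall>t \<ge> T0. \<forall>lam phi.
       let lc = 1 / (t powr (1 - \<delta>) - 1);
           \<Lambda> = lam / lc - 1;
           \<omega> = sqrt (lc * t / 2) * ln (1 + \<Lambda>) / (1 + lc);
           k = t powr (\<delta> - 1) * (1 - a t)
       in t > 1 \<and> lc \<le> lam \<and> lam \<le> t powr (1 - \<delta>) - 1 \<and> phi_adm lam phi \<longrightarrow>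
          norm (JB \<delta> t lam phi - (\<Sum>j=0..m-3. Tj j t lam k)
                - exp (\<i> * of_real t * Fz (of_real (1 - t powr (\<delta> - 1))) lam - \<i> * of_real (\<omega>^2))
                  * of_real (t powr (-1/2) * sqrt (2 / (1 + lc)))
                  * integral {\<omega>..\<omega> + a t * sqrt (lc * t / 2)} (\<lambda>\<xi>. exp (\<i> * of_real (\<xi>^2))))
          \<le> C * (real (dfact (4*m-5)) * t powr (-1/2 - real (4*m-5) * \<delta> / 2)
                   * ln t powr ((real (4*m) - 3) / 2) / a t ^ (4*m-4)
                 + t powr (-1/2 + 3*\<delta>/2) * a t ^ 4)"
      unfolding Let_def
      by (rule exI[of _ "2 * C"], rule exI[of _ T0], intro allI impI, elim conjE, rule key[OF refl refl])
  next
    fix j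
    obtain C where C: "C \<ge> 0" and bnd: "\<And>\<kappa> lam a t. steepest \<kappa> lam a t \<Longrightarrow>
      norm (Tj j t lam (\<kappa> * (1 - a))) \<le> C * (sqrt \<kappa> / ((t * \<kappa>) ^ (j + 1) * a ^ (2 * j + 1)))"
      using Tj_bound[of j] by metis
    show "\<exists>C T0. \<forall>t \<ge> T0. \<forall>lam.
       let lc = 1 / (t powr (1 - \<delta>) - 1);
           k = t powr (\<delta> - 1) * (1 - a t)
       in t > 1 \<and> lc \<le> lam \<and> lam \<le> t powr (1 - \<delta>) - 1 \<longrightarrow>
          norm (Tj j t lam k)
          \<le> C * (real (dfact (2*j-1)) * t powr (-1/2 - real (2*j+1) * \<delta> / 2) / a t ^ (2*j+1))"
      unfolding Let_def
    proof (rule exI[of _ C], rule exI[of _ T0], intro allI impI, elim conjE)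
      fix t lam :: real
      assume t: "T0 \<le> t" and lam_ge: "1 / (t powr (1 - \<delta>) - 1) \<le> lam"
      have pos: "0 < t" "0 < a t" using T0[OF t] by auto
      define Z where "Z = t powr (-1/2 - real (2*j+1) * \<delta> / 2) / a t ^ (2*j+1)"
      have "norm (Tj j t lam (t powr (\<delta> - 1) * (1 - a t))) \<le> C * Z"
        unfolding Z_def using bnd[OF st[OF t lam_ge]] unfolding T_scale[OF pos] .
      \<comment> \<open>At j = 0 the truncated \<open>2*j-1\<close> is 0 and
        \<open>dfact 0 = 1\<close>, the convention for (-1)!!.\<close>
      also have "\<dots> \<le> C * (real (dfact (2*j-1)) * Z)"
        using C pos mult_right_mono[OF dfact_ge_1[of "2*j-1"], of Z]
        by (intro mult_left_mono) (auto simp: Z_def)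
      finally show "norm (Tj j t lam (t powr (\<delta> - 1) * (1 - a t)))
          \<le> C * (real (dfact (2*j-1)) * t powr (-1/2 - real (2*j+1) * \<delta> / 2) / a t ^ (2*j+1))"
        by (simp only: Z_def times_divide_eq_right)
    qed
  qed
qed

end
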